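(* The following are equivalent over $\mathsf{RCA}_0$: (1) $\mathsf{ACA}_0$; (2) the Rival--Sands theorem for graphs $(\mathsf{RSg})$: for every infinite graph $G=(V,E)$ there is an infinite $H\subseteq V$ such that for every $x\in V$, either $H\cap N(x)$ is infinite or $|H\cap N(x)|\le 1$; (3) the refined Rival--Sands theorem for graphs $(\mathsf{RSgr})$: for every infinite graph $G=(V,E)$ there is an infinite $H\subseteq V$ such that for every $x\in V$, either $H\cap N(x)$ is infinite or $|H\cap N(x)|\le 1$, and moreover for every $x\in H$, either $H\cap N(x)$ is infinite or $H\cap N(x)=\emptyset$; (4) the statement (2) restricted to locally finite graphs; (5) the statement (3) restricted to locally finite graphs.
   Context: We work in second-order arithmetic. $\mathsf{RCA}_0$ consists of the basic axioms of a discretely ordered commutative semiring, $\Sigma^0_1$ induction and $\Delta^0_1$ comprehension; $\mathsf{ACA}_0$ is $\mathsf{RCA}_0$ plus the arithmetical comprehension scheme. A graph $G=(V,E)$ is a simple undirected graph given by sets $V\subseteq\mathbb{N}$ and $E\subseteq[V]^2$ (two-element subsets of $V$); it is infinite if $V$ is infinite. For $x\in V$, $N(x)=\{y\in V:(x,y)\in E\}$ is the set of neighbors of $x$. A graph is locally finite if $N(x)$ is finite for every $x\in V$. *)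

theory Defs
  imports Main
begin

text \<open>
  Henkin structures for the two-sorted language of second-order arithmetic. The numbers are
  all elements of the type \<^typ>\<open>'a\<close> (possibly nonstandard), the set variables range over the
  family \<open>Sets\<close> of subsets only.
\<close>

record 'a l2_structure =
  Zero :: 'a  (\<open>\<zero>\<index>\<close>)
  One  :: 'a  (\<open>\<one>\<index>\<close>)
  Plus :: "'a \<Rightarrow> 'a \<Rightarrow> 'a"  (infixl \<open>\<oplus>\<index>\<close> 65)
  Times :: "'a \<Rightarrow> 'a \<Rightarrow> 'a"  (infixl \<open>\<otimes>\<index>\<close> 70)
  Less :: "'a \<Rightarrow> 'a \<Rightarrow> bool"  (infix \<open>\<prec>\<index>\<close> 50)
  Sets :: "'a set set"

datatype tm = Var nat | Const0 | Const1 | Add tm tm | Mul tm tm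

datatype fm =
    EqF tm tm | LessF tm tm | MemF tm nat
  | Neg fm | Conj fm fm | Disj fm fm | Impl fm fm
  | AllN nat fm | ExN nat fm
  | AllS nat fm | ExS nat fm

primrec tm_vars :: "tm \<Rightarrow> nat set" where
  "tm_vars (Var x) = {x}"
| "tm_vars Const0 = {}"
| "tm_vars Const1 = {}"
| "tm_vars (Add s t) = tm_vars s \<union> tm_vars t"
| "tm_vars (Mul s t) = tm_vars s \<union> tm_vars t"

primrec tm_val :: "('a, 'm) l2_structure_scheme \<Rightarrow> (nat \<Rightarrow> 'a) \<Rightarrow> tm \<Rightarrow> 'a" where
  "tm_val M e (Var x) = e x"
| "tm_val M e Const0 = \<zero>\<^bsub>M\<^esub>"
| "tm_val M e Const1 = \<one>\<^bsub>M\<^esub>"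
| "tm_val M e (Add s t) = tm_val M e s \<oplus>\<^bsub>M\<^esub> tm_val M e t"
| "tm_val M e (Mul s t) = tm_val M e s \<otimes>\<^bsub>M\<^esub> tm_val M e t"

primrec sat ::
  "('a, 'm) l2_structure_scheme \<Rightarrow> (nat \<Rightarrow> 'a) \<Rightarrow> (nat \<Rightarrow> 'a set) \<Rightarrow> fm \<Rightarrow> bool" where
  "sat M e S (EqF s t) \<longleftrightarrow> tm_val M e s = tm_val M e t"
| "sat M e S (LessF s t) \<longleftrightarrow> tm_val M e s \<prec>\<^bsub>M\<^esub> tm_val M e t"
| "sat M e S (MemF t X) \<longleftrightarrow> tm_val M e t \<in> S X"
| "sat M e S (Neg \<phi>) \<longleftrightarrow> \<not> sat M e S \<phi>"
| "sat M e S (Conj \<phi> \<psi>) \<longleftrightarrow> sat M e S \<phi> \<and> sat M e S \<psi>"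
| "sat M e S (Disj \<phi> \<psi>) \<longleftrightarrow> sat M e S \<phi> \<or> sat M e S \<psi>"
| "sat M e S (Impl \<phi> \<psi>) \<longleftrightarrow> (sat M e S \<phi> \<longrightarrow> sat M e S \<psi>)"
| "sat M e S (AllN x \<phi>) \<longleftrightarrow> (\<forall>a. sat M (e(x := a)) S \<phi>)"
| "sat M e S (ExN x \<phi>) \<longleftrightarrow> (\<exists>a. sat M (e(x := a)) S \<phi>)"
| "sat M e S (AllS X \<phi>) \<longleftrightarrow> (\<forall>A\<in>Sets M. sat M e (S(X := A)) \<phi>)"
| "sat M e S (ExS X \<phi>) \<longleftrightarrow> (\<exists>A\<in>Sets M. sat M e (S(X := A)) \<phi>)"

inductive bounded_fm :: "fm \<Rightarrow> bool" where
  "bounded_fm (EqF s t)"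
| "bounded_fm (LessF s t)"
| "bounded_fm (MemF t X)"
| "bounded_fm \<phi> \<Longrightarrow> bounded_fm (Neg \<phi>)"
| "bounded_fm \<phi> \<Longrightarrow> bounded_fm \<psi> \<Longrightarrow> bounded_fm (Conj \<phi> \<psi>)"
| "bounded_fm \<phi> \<Longrightarrow> bounded_fm \<psi> \<Longrightarrow> bounded_fm (Disj \<phi> \<psi>)"
| "bounded_fm \<phi> \<Longrightarrow> bounded_fm \<psi> \<Longrightarrow> bounded_fm (Impl \<phi> \<psi>)"
| "bounded_fm \<phi> \<Longrightarrow> x \<notin> tm_vars t \<Longrightarrow> bounded_fm (AllN x (Impl (LessF (Var x) t) \<phi>))"
| "bounded_fm \<phi> \<Longrightarrow> x \<notin> tm_vars t \<Longrightarrow> bounded_fm (ExN x (Conj (LessF (Var x) t) \<phi>))"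

definition Sigma01 :: "fm \<Rightarrow> bool" where
  "Sigma01 \<phi> \<longleftrightarrow> (\<exists>x \<theta>. bounded_fm \<theta> \<and> \<phi> = ExN x \<theta>)"

definition Pi01 :: "fm \<Rightarrow> bool" where
  "Pi01 \<phi> \<longleftrightarrow> (\<exists>x \<theta>. bounded_fm \<theta> \<and> \<phi> = AllN x \<theta>)"

text \<open>Set parameters are allowed in arithmetical formulas, set quantifiers are not.\<close>

primrec arithmetical :: "fm \<Rightarrow> bool" where
  "arithmetical (EqF s t) \<longleftrightarrow> True"
| "arithmetical (LessF s t) \<longleftrightarrow> True"
| "arithmetical (MemF t X) \<longleftrightarrow> True"
| "arithmetical (Neg \<phi>) \<longleftrightarrow> arithmetical \<phi>"
| "arithmetical (Conj \<phi> \<psi>) \<longleftrightarrow> arithmetical \<phi> \<and> arithmetical \<psi>"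
| "arithmetical (Disj \<phi> \<psi>) \<longleftrightarrow> arithmetical \<phi> \<and> arithmetical \<psi>"
| "arithmetical (Impl \<phi> \<psi>) \<longleftrightarrow> arithmetical \<phi> \<and> arithmetical \<psi>"
| "arithmetical (AllN x \<phi>) \<longleftrightarrow> arithmetical \<phi>"
| "arithmetical (ExN x \<phi>) \<longleftrightarrow> arithmetical \<phi>"
| "arithmetical (AllS X \<phi>) \<longleftrightarrow> False"
| "arithmetical (ExS X \<phi>) \<longleftrightarrow> False"

text \<open>
  The axioms of (the nonnegative part of) a discretely ordered commutative ring,
  i.e. the usual finite axiomatization of \<open>PA\<^sup>-\<close>.
\<close>

definition discretely_ordered_semiring :: "('a, 'm) l2_structure_scheme \<Rightarrow> bool" where
  "discretely_ordered_semiring M \<longleftrightarrow>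
     (\<forall>x y z. (x \<oplus>\<^bsub>M\<^esub> y) \<oplus>\<^bsub>M\<^esub> z = x \<oplus>\<^bsub>M\<^esub> (y \<oplus>\<^bsub>M\<^esub> z)) \<and>
     (\<forall>x y. x \<oplus>\<^bsub>M\<^esub> y = y \<oplus>\<^bsub>M\<^esub> x) \<and>
     (\<forall>x y z. (x \<otimes>\<^bsub>M\<^esub> y) \<otimes>\<^bsub>M\<^esub> z = x \<otimes>\<^bsub>M\<^esub> (y \<otimes>\<^bsub>M\<^esub> z)) \<and>
     (\<forall>x y. x \<otimes>\<^bsub>M\<^esub> y = y \<otimes>\<^bsub>M\<^esub> x) \<and>
     (\<forall>x y z. x \<otimes>\<^bsub>M\<^esub> (y \<oplus>\<^bsub>M\<^esub> z) = x \<otimes>\<^bsub>M\<^esub> y \<oplus>\<^bsub>M\<^esub> x \<otimes>\<^bsub>M\<^esub> z) \<and>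
     (\<forall>x. x \<oplus>\<^bsub>M\<^esub> \<zero>\<^bsub>M\<^esub> = x) \<and>
     (\<forall>x. x \<otimes>\<^bsub>M\<^esub> \<zero>\<^bsub>M\<^esub> = \<zero>\<^bsub>M\<^esub>) \<and>
     (\<forall>x. x \<otimes>\<^bsub>M\<^esub> \<one>\<^bsub>M\<^esub> = x) \<and>
     (\<forall>x. \<not> x \<prec>\<^bsub>M\<^esub> x) \<and>
     (\<forall>x y z. x \<prec>\<^bsub>M\<^esub> y \<and> y \<prec>\<^bsub>M\<^esub> z \<longrightarrow> x \<prec>\<^bsub>M\<^esub> z) \<and>
     (\<forall>x y. x \<prec>\<^bsub>M\<^esub> y \<or> x = y \<or> y \<prec>\<^bsub>M\<^esub> x) \<and>
     (\<forall>x y z. x \<prec>\<^bsub>M\<^esub> y \<longrightarrow> x \<oplus>\<^bsub>M\<^esub> z \<prec>\<^bsub>M\<^esub> y \<oplus>\<^bsub>M\<^esub> z) \<and>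
     (\<forall>x y z. \<zero>\<^bsub>M\<^esub> \<prec>\<^bsub>M\<^esub> z \<and> x \<prec>\<^bsub>M\<^esub> y \<longrightarrow> x \<otimes>\<^bsub>M\<^esub> z \<prec>\<^bsub>M\<^esub> y \<otimes>\<^bsub>M\<^esub> z) \<and>
     (\<forall>x y. x \<prec>\<^bsub>M\<^esub> y \<longrightarrow> (\<exists>z. x \<oplus>\<^bsub>M\<^esub> z = y)) \<and>
     \<zero>\<^bsub>M\<^esub> \<prec>\<^bsub>M\<^esub> \<one>\<^bsub>M\<^esub> \<and>
     (\<forall>x. \<zero>\<^bsub>M\<^esub> \<prec>\<^bsub>M\<^esub> x \<longrightarrow> x = \<one>\<^bsub>M\<^esub> \<or> \<one>\<^bsub>M\<^esub> \<prec>\<^bsub>M\<^esub> x) \<and>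
     (\<forall>x. x = \<zero>\<^bsub>M\<^esub> \<or> \<zero>\<^bsub>M\<^esub> \<prec>\<^bsub>M\<^esub> x)"

text \<open>
  In the schemes below the assignments \<open>e\<close> and \<open>S\<close> supply the number and set parameters of the
  formulas, so that quantifying over them amounts to taking universal closures; \<open>\<phi>(a)\<close> is
  rendered by updating \<open>e\<close> at the distinguished variable \<open>x\<close>.
\<close>

definition Sigma01_induction :: "('a, 'm) l2_structure_scheme \<Rightarrow> bool" where
  "Sigma01_induction M \<longleftrightarrow>
     (\<forall>\<phi> x e S. Sigma01 \<phi> \<longrightarrow> range S \<subseteq> Sets M \<longrightarrow>
        sat M (e(x := \<zero>\<^bsub>M\<^esub>)) S \<phi> \<longrightarrow>
        (\<forall>a. sat M (e(x := a)) S \<phi> \<longrightarrow> sat M (e(x := a \<oplus>\<^bsub>M\<^esub> \<one>\<^bsub>M\<^esub>)) S \<phi>) \<longrightarrow>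
        (\<forall>a. sat M (e(x := a)) S \<phi>))"

definition Delta01_comprehension :: "('a, 'm) l2_structure_scheme \<Rightarrow> bool" where
  "Delta01_comprehension M \<longleftrightarrow>
     (\<forall>\<phi> \<psi> x e S. Sigma01 \<phi> \<longrightarrow> Pi01 \<psi> \<longrightarrow> range S \<subseteq> Sets M \<longrightarrow>
        (\<forall>a. sat M (e(x := a)) S \<phi> \<longleftrightarrow> sat M (e(x := a)) S \<psi>) \<longrightarrow>
        (\<exists>A\<in>Sets M. \<forall>a. a \<in> A \<longleftrightarrow> sat M (e(x := a)) S \<phi>))"

definition arithmetical_comprehension :: "('a, 'm) l2_structure_scheme \<Rightarrow> bool" where
  "arithmetical_comprehension M \<longleftrightarrow>
     (\<forall>\<phi> x e S. arithmetical \<phi> \<longrightarrow> range S \<subseteq> Sets M \<longrightarrow>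
        (\<exists>A\<in>Sets M. \<forall>a. a \<in> A \<longleftrightarrow> sat M (e(x := a)) S \<phi>))"

text \<open>
  Both sorts of a structure are nonempty; for the second sort this has to be required, since
  otherwise there would be no assignments \<open>S\<close> and the schemes would hold vacuously.
\<close>

definition RCA0 :: "('a, 'm) l2_structure_scheme \<Rightarrow> bool" where
  "RCA0 M \<longleftrightarrow> Sets M \<noteq> {} \<and> discretely_ordered_semiring M \<and>
     Sigma01_induction M \<and> Delta01_comprehension M"

definition ACA0 :: "('a, 'm) l2_structure_scheme \<Rightarrow> bool" where
  "ACA0 M \<longleftrightarrow> RCA0 M \<and> arithmetical_comprehension M"

text \<open>
  Finiteness is meant internally to \<open>M\<close>, as boundedness. In a nonstandard structure it
  differs from \<^const>\<open>finite\<close>.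
\<close>

definition internally_finite :: "('a, 'm) l2_structure_scheme \<Rightarrow> 'a set \<Rightarrow> bool" where
  "internally_finite M A \<longleftrightarrow> (\<exists>b. \<forall>y\<in>A. y \<prec>\<^bsub>M\<^esub> b)"

abbreviation internally_infinite :: "('a, 'm) l2_structure_scheme \<Rightarrow> 'a set \<Rightarrow> bool" where
  "internally_infinite M A \<equiv> \<not> internally_finite M A"

definition pair_code :: "('a, 'm) l2_structure_scheme \<Rightarrow> 'a \<Rightarrow> 'a \<Rightarrow> 'a" where
  "pair_code M x y = (x \<oplus>\<^bsub>M\<^esub> y) \<otimes>\<^bsub>M\<^esub> (x \<oplus>\<^bsub>M\<^esub> y) \<oplus>\<^bsub>M\<^esub> x"

text \<open>A two-element set \<open>{x, y}\<close> with \<open>x \<prec> y\<close> is coded by the pair \<open>(x, y)\<close>.\<close>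

definition two_subsets :: "('a, 'm) l2_structure_scheme \<Rightarrow> 'a set \<Rightarrow> 'a set" where
  "two_subsets M V = {pair_code M x y | x y. x \<in> V \<and> y \<in> V \<and> x \<prec>\<^bsub>M\<^esub> y}"

definition coded_graph :: "('a, 'm) l2_structure_scheme \<Rightarrow> 'a set \<Rightarrow> 'a set \<Rightarrow> bool" where
  "coded_graph M V E \<longleftrightarrow> V \<in> Sets M \<and> E \<in> Sets M \<and> E \<subseteq> two_subsets M V"

definition nbrs :: "('a, 'm) l2_structure_scheme \<Rightarrow> 'a set \<Rightarrow> 'a set \<Rightarrow> 'a \<Rightarrow> 'a set" where
  "nbrs M V E x =
     {y \<in> V. (x \<prec>\<^bsub>M\<^esub> y \<and> pair_code M x y \<in> E) \<or> (y \<prec>\<^bsub>M\<^esub> x \<and> pair_code M y x \<in> E)}"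

definition locally_finite :: "('a, 'm) l2_structure_scheme \<Rightarrow> 'a set \<Rightarrow> 'a set \<Rightarrow> bool" where
  "locally_finite M V E \<longleftrightarrow> (\<forall>x\<in>V. internally_finite M (nbrs M V E x))"

definition RS_solution ::
  "('a, 'm) l2_structure_scheme \<Rightarrow> 'a set \<Rightarrow> 'a set \<Rightarrow> 'a set \<Rightarrow> bool" where
  "RS_solution M V E H \<longleftrightarrow>
     H \<in> Sets M \<and> H \<subseteq> V \<and> internally_infinite M H \<and>
     (\<forall>x\<in>V. internally_infinite M (H \<inter> nbrs M V E x) \<or>
             (\<forall>y\<in>H \<inter> nbrs M V E x. \<forall>z\<in>H \<inter> nbrs M V E x. y = z))"

definition RS_refined_solution ::
  "('a, 'm) l2_structure_scheme \<Rightarrow> 'a set \<Rightarrow> 'a set \<Rightarrow> 'a set \<Rightarrow> bool" where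
  "RS_refined_solution M V E H \<longleftrightarrow>
     RS_solution M V E H \<and>
     (\<forall>x\<in>H. internally_infinite M (H \<inter> nbrs M V E x) \<or> H \<inter> nbrs M V E x = {})"

definition RSg :: "('a, 'm) l2_structure_scheme \<Rightarrow> bool" where
  "RSg M \<longleftrightarrow>
     (\<forall>V E. coded_graph M V E \<and> internally_infinite M V \<longrightarrow> (\<exists>H. RS_solution M V E H))"

definition RSgr :: "('a, 'm) l2_structure_scheme \<Rightarrow> bool" where
  "RSgr M \<longleftrightarrow>
     (\<forall>V E. coded_graph M V E \<and> internally_infinite M V \<longrightarrow> (\<exists>H. RS_refined_solution M V E H))"

definition RSg_locally_finite :: "('a, 'm) l2_structure_scheme \<Rightarrow> bool" where
  "RSg_locally_finite M \<longleftrightarrow>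
     (\<forall>V E. coded_graph M V E \<and> internally_infinite M V \<and> locally_finite M V E \<longrightarrow>
        (\<exists>H. RS_solution M V E H))"

definition RSgr_locally_finite :: "('a, 'm) l2_structure_scheme \<Rightarrow> bool" where
  "RSgr_locally_finite M \<longleftrightarrow>
     (\<forall>V E. coded_graph M V E \<and> internally_infinite M V \<and> locally_finite M V E \<longrightarrow>
        (\<exists>H. RS_refined_solution M V E H))"

end

theory Submission
  imports Defs
begin

text \<open>
  From ACA to the refined theorem: let \<open>F\<close> be the set of vertices with finitely many neighbours. If
  \<open>F\<close> is finite, all sufficiently large vertices form a solution. If \<open>F\<close> is infinite, a subset \<open>H\<close> of
  \<open>F\<close> is built recursively which meets every infinite \<open>F \<inter> N(y)\<close> infinitely often; whenever \<open>h\<close> is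
  put into \<open>H\<close>, all later elements avoid \<open>N(h)\<close> and the finite sets among the \<open>F \<inter> N(y)\<close> for the
  finitely many neighbours \<open>y\<close> of \<open>h\<close>.

  From the locally finite theorem to ACA: the projection of a set of pairs is computed from a
  solution for a graph in which consecutive elements of any solution must dominate the
  function of least witnesses; local finiteness of this graph is strong \<open>\<Sigma>\<^sup>0\<^sub>1\<close> bounding. Closure
  of the sets under projections yields arithmetical comprehension by induction on formulas.

  Finite sets are coded inside the possibly nonstandard model by divisibility:
  \<open>x\<close> belongs to the set coded by \<open>(c, m)\<close> if \<open>1 + (x + 1) m\<close> divides \<open>c\<close>.
\<close>

section \<open>Arithmetic in discretely ordered semirings\<close>

locale ordered_semiring_structure =
  fixes M :: "('a, 'm) l2_structure_scheme" (structure)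
  assumes dos: "discretely_ordered_semiring M"
begin

definition leq :: "'a \<Rightarrow> 'a \<Rightarrow> bool"  (infix \<open>\<preceq>\<close> 50) where
  "x \<preceq> y \<longleftrightarrow> x \<prec> y \<or> x = y"

text \<open>The language has no subtraction, but \<open>linordered_semidom\<close> asks for one. The
  default \<open>\<zero>\<close> makes \<open>monus_monus\<close> and
  \<open>times_monus_distrib\<close> hold for all arguments, as that class demands.\<close>

definition monus :: "'a \<Rightarrow> 'a \<Rightarrow> 'a" where
  "monus x y = (if y \<preceq> x then SOME z. y \<oplus> z = x else \<zero>)"

lemma
  shows plus_assoc [rule_format]: "\<forall>x y z. (x \<oplus> y) \<oplus> z = x \<oplus> (y \<oplus> z)"
    and plus_commute [rule_format]: "\<forall>x y. x \<oplus> y = y \<oplus> x"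
    and times_assoc [rule_format]: "\<forall>x y z. (x \<otimes> y) \<otimes> z = x \<otimes> (y \<otimes> z)"
    and times_commute [rule_format]: "\<forall>x y. x \<otimes> y = y \<otimes> x"
    and distrib [rule_format]: "\<forall>x y z. x \<otimes> (y \<oplus> z) = x \<otimes> y \<oplus> x \<otimes> z"
    and plus_zero [rule_format]: "\<forall>x. x \<oplus> \<zero> = x"
    and times_zero [rule_format]: "\<forall>x. x \<otimes> \<zero> = \<zero>"
    and times_one [rule_format]: "\<forall>x. x \<otimes> \<one> = x"
    and prec_irrefl [rule_format]: "\<forall>x. \<not> x \<prec> x"
    and prec_trans [rule_format, OF conjI]: "\<forall>x y z. x \<prec> y \<and> y \<prec> z \<longrightarrow> x \<prec> z"
    and prec_total [rule_format]: "\<forall>x y. x \<prec> y \<or> x = y \<or> y \<prec> x"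
    and plus_mono [rule_format]: "\<forall>x y z. x \<prec> y \<longrightarrow> x \<oplus> z \<prec> y \<oplus> z"
    and times_mono [rule_format, OF conjI]:
      "\<forall>x y z. \<zero> \<prec> z \<and> x \<prec> y \<longrightarrow> x \<otimes> z \<prec> y \<otimes> z"
    and diff_exists [rule_format]: "\<forall>x y. x \<prec> y \<longrightarrow> (\<exists>z. x \<oplus> z = y)"
    and zero_prec_one: "\<zero> \<prec> \<one>"
    and one_least [rule_format]: "\<forall>x. \<zero> \<prec> x \<longrightarrow> x = \<one> \<or> \<one> \<prec> x"
    and zero_least [rule_format]: "\<forall>x. x = \<zero> \<or> \<zero> \<prec> x"
  using dos unfolding discretely_ordered_semiring_def by - (elim conjE, assumption)+

lemma plus_cancel: "x \<oplus> y = x \<oplus> z \<Longrightarrow> y = z"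
  using plus_mono[of y z x] plus_mono[of z y x] prec_total[of y z] prec_irrefl
  by (auto simp: plus_commute[of _ x])

lemma plus_monus: "y \<preceq> x \<Longrightarrow> y \<oplus> monus x y = x"
proof -
  assume "y \<preceq> x"
  then have "\<exists>z. y \<oplus> z = x"
    unfolding leq_def using diff_exists plus_zero by blast
  then have "y \<oplus> (SOME z. y \<oplus> z = x) = x" by (rule someI_ex)
  with \<open>y \<preceq> x\<close> show ?thesis by (simp add: monus_def)
qed

lemma leq_plus: "x \<preceq> x \<oplus> y"
  using zero_least[of y] plus_mono[of "\<zero>" y x] plus_commute plus_zero
  unfolding leq_def by metis

lemma monus_plus: "monus (x \<oplus> y) x = y"
  using plus_monus[OF leq_plus] plus_cancel by blast

lemma monus_unique: "b \<oplus> c = a \<Longrightarrow> monus a b = c"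
  using monus_plus by blast

lemma leq_iff: "x \<preceq> y \<longleftrightarrow> (\<exists>z. x \<oplus> z = y)"
  using leq_plus plus_monus by blast

lemma not_leq: "\<not> x \<preceq> y \<longleftrightarrow> y \<prec> x"
  using prec_total[of x y] prec_irrefl prec_trans[of x y x] unfolding leq_def by blast

lemma times_monus_distrib: "a \<otimes> monus b c = monus (a \<otimes> b) (a \<otimes> c)"
proof (cases "c \<preceq> b")
  case True
  then have "a \<otimes> c \<oplus> a \<otimes> monus b c = a \<otimes> b"
    by (simp add: distrib[symmetric] plus_monus)
  then show ?thesis using monus_unique by metis
next
  case False
  show ?thesis
  proof (cases "a = \<zero>")
    case True
    then show ?thesis
      using monus_unique[OF plus_zero] times_zero times_commute by metis
  next
    case a: False
    then have "b \<otimes> a \<prec> c \<otimes> a"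
      using False times_mono zero_least not_leq by metis
    then have "\<not> c \<otimes> a \<preceq> b \<otimes> a"
      using not_leq by blast
    with False show ?thesis
      by (simp add: monus_def times_commute[of a] times_zero[of a, unfolded times_commute[of a]])
  qed
qed

lemma monus_monus: "monus (monus a b) c = monus a (b \<oplus> c)"
proof (cases "b \<oplus> c \<preceq> a")
  case True
  then obtain d where "b \<oplus> c \<oplus> d = a" using leq_iff by blast
  then show ?thesis
    using plus_assoc monus_unique by metis
next
  case no: False
  show ?thesis
  proof (cases "b \<preceq> a")
    case True
    then obtain d where d: "b \<oplus> d = a" using leq_iff by blast
    then have "\<not> c \<preceq> d"
      using no leq_iff plus_assoc by metis
    with no show ?thesis
      unfolding monus_unique[OF d] by (simp add: monus_def)
  next
    case False
    moreover have "monus \<zero> c = \<zero>"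
      using monus_unique[OF plus_zero] not_leq zero_least unfolding monus_def by metis
    ultimately show ?thesis
      using no by (simp add: monus_def[of a])
  qed
qed

text \<open>Makes the library's facts on ordered semirings and divisibility available for
  \<open>M\<close> under the prefix \<open>N\<close>. Discreteness and the leastness of
  \<open>\<zero>\<close> lie outside this class and enter through the lemmas below.\<close>

sublocale N: linordered_semidom "(\<oplus>)" monus "(\<preceq>)" "(\<prec>)" "\<zero>" "(\<otimes>)" "\<one>"
proof unfold_locales
  fix a b c :: 'a
  show "a \<oplus> b \<oplus> c = a \<oplus> (b \<oplus> c)" by (rule plus_assoc)
  show "a \<oplus> b = b \<oplus> a" by (rule plus_commute)
  show "monus (a \<oplus> b) a = b" by (rule monus_plus)
  show "monus (monus a b) c = monus a (b \<oplus> c)" by (rule monus_monus)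
  show "a \<prec> b \<longleftrightarrow> a \<preceq> b \<and> \<not> b \<preceq> a"
    using not_leq prec_irrefl unfolding leq_def by blast
  show "a \<preceq> a" by (simp add: leq_def)
  show "a \<preceq> c" if "a \<preceq> b" "b \<preceq> c"
    using that prec_trans unfolding leq_def by blast
  show "a = b" if "a \<preceq> b" "b \<preceq> a"
    using that not_leq unfolding leq_def by blast
  show "c \<oplus> a \<preceq> c \<oplus> b" if "a \<preceq> b"
    using that leq_iff plus_assoc by metis
  show "a \<preceq> b \<or> b \<preceq> a"
    using prec_total unfolding leq_def by blast
  show "\<zero> \<oplus> a = a" using plus_zero plus_commute by metis
  show "\<zero> \<otimes> a = \<zero>" using times_zero times_commute by metis
  show "a \<otimes> \<zero> = \<zero>" by (rule times_zero)
  show "a \<otimes> b \<otimes> c = a \<otimes> (b \<otimes> c)" by (rule times_assoc)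
  show "a \<otimes> b = b \<otimes> a" by (rule times_commute)
  show "(a \<oplus> b) \<otimes> c = a \<otimes> c \<oplus> b \<otimes> c"
    using distrib times_commute by metis
  show "a \<otimes> (b \<oplus> c) = a \<otimes> b \<oplus> a \<otimes> c" by (rule distrib)
  show "\<one> \<otimes> a = a" using times_one times_commute by metis
  show "a \<otimes> monus b c = monus (a \<otimes> b) (a \<otimes> c)"
    by (rule times_monus_distrib)
  show "\<zero> \<noteq> \<one>" using zero_prec_one prec_irrefl by metis
  show "\<zero> \<prec> \<one>" by (rule zero_prec_one)
  show "c \<otimes> a \<prec> c \<otimes> b" if "a \<prec> b" "\<zero> \<prec> c"
    using that times_mono times_commute by metis
  show "a \<otimes> b \<noteq> \<zero>" if "a \<noteq> \<zero>" "b \<noteq> \<zero>"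
    using that times_mono[of b "\<zero>" a] zero_least times_zero times_commute prec_irrefl by metis
  show "monus a b \<oplus> b = a" if "b \<preceq> a"
    using that plus_monus plus_commute by metis
qed

section \<open>Successors and pairing\<close>

lemma zero_leq [simp]: "\<zero> \<preceq> x"
  using zero_least[of x] by (auto simp: leq_def)

lemma not_prec_zero [simp]: "\<not> x \<prec> \<zero>"
  by (simp add: N.not_less)

text \<open>Discreteness enters here: a nonzero difference is at least
  \<open>\<one>\<close>.\<close>

lemma prec_succ_iff: "x \<prec> y \<oplus> \<one> \<longleftrightarrow> x \<preceq> y"
proof
  assume "x \<preceq> y"
  then show "x \<prec> y \<oplus> \<one>"
    using N.le_less_trans[of x y "y \<oplus> \<one>"] by simp
next
  assume *: "x \<prec> y \<oplus> \<one>"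
  show "x \<preceq> y"
  proof (rule ccontr)
    assume "\<not> x \<preceq> y"
    then have "y \<preceq> x" "y \<noteq> x" by (auto simp: not_leq leq_def prec_irrefl)
    then obtain d where d: "y \<oplus> d = x" "d \<noteq> \<zero>" using leq_iff by auto
    then have "\<one> \<preceq> d" using one_least zero_least unfolding leq_def by blast
    with d have "y \<oplus> \<one> \<preceq> x" by auto
    with * show False using not_leq by blast
  qed
qed

lemma prec_succ_cases: "x \<prec> y \<oplus> \<one> \<longleftrightarrow> x \<prec> y \<or> x = y"
  by (simp add: prec_succ_iff leq_def)

lemma succ_leq_iff: "x \<oplus> \<one> \<preceq> y \<longleftrightarrow> x \<prec> y"
  using prec_succ_iff[of y x] not_leq by blast

text \<open>With \<open>s = x \<oplus> y\<close>, the code lies between \<open>s \<otimes> s\<close>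
  and \<open>s \<otimes> s \<oplus> s\<close>, hence below the square of
  \<open>s \<oplus> \<one>\<close>. Codes are thus ordered by the sum first, which yields
  injectivity.\<close>

lemma pair_prec:
  assumes "x \<oplus> y \<prec> x' \<oplus> y'"
  shows "pair_code M x y \<prec> pair_code M x' y'"
proof -
  define s where "s = x \<oplus> y"
  define t where "t = x' \<oplus> y'"
  have "x \<preceq> s" by (simp add: s_def)
  then have "s \<otimes> s \<oplus> x \<preceq> s \<otimes> s \<oplus> s" by simp
  also have "\<dots> \<prec> (s \<oplus> \<one>) \<otimes> (s \<oplus> \<one>)"
    using prec_succ_iff[of "s \<otimes> s \<oplus> s" "s \<otimes> s \<oplus> s \<oplus> s"]
    by (simp add: N.distrib_left N.distrib_right N.add.assoc)
  also have "\<dots> \<preceq> t \<otimes> t"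
    using assms by (intro N.mult_mono) (simp_all add: s_def t_def succ_leq_iff)
  also have "\<dots> \<preceq> t \<otimes> t \<oplus> x'" by simp
  finally show ?thesis by (simp add: pair_code_def s_def t_def)
qed

lemma pair_inject [simp]: "pair_code M x y = pair_code M x' y' \<longleftrightarrow> x = x' \<and> y = y'"
proof
  assume *: "pair_code M x y = pair_code M x' y'"
  then have "x \<oplus> y = x' \<oplus> y'"
    using pair_prec[of x y x' y'] pair_prec[of x' y' x y] prec_total[of "x \<oplus> y" "x' \<oplus> y'"] by auto
  with * show "x = x' \<and> y = y'" by (auto simp: pair_code_def)
qed simp

lemma leq_pair_fst [simp]: "x \<preceq> pair_code M x y"
  by (simp add: pair_code_def)

lemma leq_square: "x \<preceq> x \<otimes> x"
  using one_least[of x] zero_least[of x] N.mult_left_mono[of "\<one>" x x]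
  by (auto simp: leq_def)

lemma leq_pair_snd [simp]: "y \<preceq> pair_code M x y"
proof -
  have "y \<preceq> x \<oplus> y" by simp
  also have "\<dots> \<preceq> (x \<oplus> y) \<otimes> (x \<oplus> y)" by (rule leq_square)
  also have "\<dots> \<preceq> pair_code M x y" by (simp add: pair_code_def)
  finally show ?thesis .
qed

lemma pair_mono: "x \<preceq> x' \<Longrightarrow> y \<preceq> y' \<Longrightarrow> pair_code M x y \<preceq> pair_code M x' y'"
  unfolding pair_code_def by (intro N.add_mono N.mult_mono) auto

section \<open>Divisibility and coprime moduli\<close>

notation N.dvd (infix \<open>divs\<close> 50)

text \<open>A bounded quotient makes divisibility expressible by a bounded formula. For
  \<open>s = \<zero>\<close> the given quotient may be too large and is replaced by
  \<open>\<zero>\<close>.\<close>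

lemma divs_bounded: "s divs t \<longleftrightarrow> (\<exists>q. q \<prec> t \<oplus> \<one> \<and> t = s \<otimes> q)"
proof
  assume "s divs t"
  then obtain q where q: "t = s \<otimes> q" by (auto elim: N.dvdE)
  show "\<exists>q. q \<prec> t \<oplus> \<one> \<and> t = s \<otimes> q"
  proof (cases "s = \<zero>")
    case True
    with q show ?thesis
      by (intro exI[of _ "\<zero>"]) (simp add: prec_succ_iff)
  next
    case False
    then have "\<one> \<preceq> s" using one_least[of s] zero_least[of s] by (auto simp: leq_def)
    then have "\<one> \<otimes> q \<preceq> s \<otimes> q" by (intro N.mult_right_mono) simp_all
    with q show ?thesis by (auto simp: prec_succ_iff)
  qed
qed (auto intro: N.dvdI)

text \<open>Put \<open>u = k \<otimes> m\<close>. Comparing the two moduli shows that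
  \<open>\<one> \<oplus> u\<close> divides \<open>t \<otimes> m \<otimes> d\<close>, and therefore
  its multiple \<open>u \<otimes> u \<otimes> d\<close>, because \<open>t\<close> divides
  \<open>m\<close>. Modulo \<open>\<one> \<oplus> u\<close> the factor \<open>u\<close> acts as
  minus one, so it can be removed twice.\<close>

lemma coprime_moduli:
  assumes t: "t divs m" and k: "k' = k \<oplus> t \<or> k = k' \<oplus> t"
    and d: "(\<one> \<oplus> k \<otimes> m) divs ((\<one> \<oplus> k' \<otimes> m) \<otimes> d)"
  shows "(\<one> \<oplus> k \<otimes> m) divs d"
proof -
  define u where "u = k \<otimes> m"
  have "(\<one> \<oplus> u) divs (t \<otimes> m \<otimes> d)"
    using k
  proof
    assume "k' = k \<oplus> t"
    then have "(\<one> \<oplus> k' \<otimes> m) \<otimes> d = (\<one> \<oplus> u) \<otimes> d \<oplus> t \<otimes> m \<otimes> d"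
      by (simp add: u_def N.distrib_right N.add.assoc)
    with d show ?thesis
      using N.dvd_add_right_iff[of "\<one> \<oplus> u" "(\<one> \<oplus> u) \<otimes> d"] by (simp add: u_def)
  next
    assume "k = k' \<oplus> t"
    then have "(\<one> \<oplus> u) \<otimes> d = (\<one> \<oplus> k' \<otimes> m) \<otimes> d \<oplus> t \<otimes> m \<otimes> d"
      by (simp add: u_def N.distrib_right N.add.assoc)
    then show ?thesis
      using d N.dvd_add_right_iff[of "\<one> \<oplus> u" "(\<one> \<oplus> k' \<otimes> m) \<otimes> d" "t \<otimes> m \<otimes> d"]
      by (metis u_def N.dvd_triv_left)
  qed
  moreover obtain q where "m = t \<otimes> q" using t by (auto elim: N.dvdE)
  then have "u \<otimes> u \<otimes> d = (t \<otimes> m \<otimes> d) \<otimes> (k \<otimes> k \<otimes> q)"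
    unfolding u_def by (simp only: N.mult.assoc N.mult.commute N.mult.left_commute)
  ultimately have uu: "(\<one> \<oplus> u) divs (u \<otimes> u \<otimes> d)"
    by simp
  have "(\<one> \<oplus> u) \<otimes> (u \<otimes> d) = u \<otimes> u \<otimes> d \<oplus> u \<otimes> d"
    by (simp add: N.distrib_right N.mult.assoc N.add.commute)
  with uu have ud: "(\<one> \<oplus> u) divs (u \<otimes> d)"
    using N.dvd_add_right_iff[OF uu] by (metis N.dvd_triv_left)
  have "(\<one> \<oplus> u) \<otimes> d = u \<otimes> d \<oplus> d"
    by (simp add: N.distrib_right N.add.commute)
  then show ?thesis
    using N.dvd_add_right_iff[OF ud] unfolding u_def by (metis N.dvd_triv_left)
qed

end

section \<open>Decidable predicates\<close>

lemma finite_tm_vars: "finite (tm_vars t)"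
  by (induction t) auto

lemma tm_val_cong: "(\<And>x. x \<in> tm_vars t \<Longrightarrow> e x = e' x) \<Longrightarrow> tm_val M e t = tm_val M e' t"
  by (induction t) auto

lemma tm_val_cong_below:
  "\<exists>n. \<forall>e e'. (\<forall>i<n. e i = e' i) \<longrightarrow> tm_val M e t = tm_val M e' t"
proof -
  obtain n where "\<forall>x\<in>tm_vars t. x < n"
    using finite_tm_vars finite_nat_set_iff_bounded by blast
  then show ?thesis
    by (intro exI[of _ n] allI impI tm_val_cong) simp
qed

text \<open>Supplies fresh variables and a fixed arity for tuple codes. The bound \<open>n\<close>
  is uniform in \<open>S\<close> because set quantifiers change the set assignment.\<close>

lemma sat_cong: "\<exists>n. \<forall>e e' S. (\<forall>i<n. e i = e' i) \<longrightarrow> sat M e S \<phi> = sat M e' S \<phi>"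
proof (induction \<phi>)
  case (EqF s t)
  obtain n m where
    n: "\<forall>e e'. (\<forall>i<n. e i = e' i) \<longrightarrow> tm_val M e s = tm_val M e' s" and
    m: "\<forall>e e'. (\<forall>i<m. e i = e' i) \<longrightarrow> tm_val M e t = tm_val M e' t"
    using tm_val_cong_below by metis
  have "tm_val M e s = tm_val M e' s" "tm_val M e t = tm_val M e' t"
    if "\<forall>i<max n m. e i = e' i" for e e'
    using that n[rule_format, of e e'] m[rule_format, of e e'] by simp_all
  then show ?case by (intro exI[of _ "max n m"] allI impI) (simp only: sat.simps)
next
  case (LessF s t)
  obtain n m where
    n: "\<forall>e e'. (\<forall>i<n. e i = e' i) \<longrightarrow> tm_val M e s = tm_val M e' s" and
    m: "\<forall>e e'. (\<forall>i<m. e i = e' i) \<longrightarrow> tm_val M e t = tm_val M e' t"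
    using tm_val_cong_below by metis
  have "tm_val M e s = tm_val M e' s" "tm_val M e t = tm_val M e' t"
    if "\<forall>i<max n m. e i = e' i" for e e'
    using that n[rule_format, of e e'] m[rule_format, of e e'] by simp_all
  then show ?case by (intro exI[of _ "max n m"] allI impI) (simp only: sat.simps)
next
  case (MemF t X)
  obtain n where n: "\<forall>e e'. (\<forall>i<n. e i = e' i) \<longrightarrow> tm_val M e t = tm_val M e' t"
    using tm_val_cong_below by metis
  have "tm_val M e t = tm_val M e' t" if "\<forall>i<n. e i = e' i" for e e'
    using that n[rule_format, of e e'] by simp
  then show ?case by (intro exI[of _ n] allI impI) (simp only: sat.simps)
next
  case (Neg \<phi>)
  then show ?case by simp
next
  case (Conj \<phi> \<psi>)
  then obtain n m where
    n: "\<forall>e e' S. (\<forall>i<n. e i = e' i) \<longrightarrow> sat M e S \<phi> = sat M e' S \<phi>" and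
    m: "\<forall>e e' S. (\<forall>i<m. e i = e' i) \<longrightarrow> sat M e S \<psi> = sat M e' S \<psi>" by blast
  have "sat M e S \<phi> = sat M e' S \<phi>" "sat M e S \<psi> = sat M e' S \<psi>"
    if "\<forall>i<max n m. e i = e' i" for e e' S
    using that n[rule_format, of e e' S] m[rule_format, of e e' S] by simp_all
  then show ?case by (intro exI[of _ "max n m"] allI impI) (simp only: sat.simps)
next
  case (Disj \<phi> \<psi>)
  then obtain n m where
    n: "\<forall>e e' S. (\<forall>i<n. e i = e' i) \<longrightarrow> sat M e S \<phi> = sat M e' S \<phi>" and
    m: "\<forall>e e' S. (\<forall>i<m. e i = e' i) \<longrightarrow> sat M e S \<psi> = sat M e' S \<psi>" by blast
  have "sat M e S \<phi> = sat M e' S \<phi>" "sat M e S \<psi> = sat M e' S \<psi>"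
    if "\<forall>i<max n m. e i = e' i" for e e' S
    using that n[rule_format, of e e' S] m[rule_format, of e e' S] by simp_all
  then show ?case by (intro exI[of _ "max n m"] allI impI) (simp only: sat.simps)
next
  case (Impl \<phi> \<psi>)
  then obtain n m where
    n: "\<forall>e e' S. (\<forall>i<n. e i = e' i) \<longrightarrow> sat M e S \<phi> = sat M e' S \<phi>" and
    m: "\<forall>e e' S. (\<forall>i<m. e i = e' i) \<longrightarrow> sat M e S \<psi> = sat M e' S \<psi>" by blast
  have "sat M e S \<phi> = sat M e' S \<phi>" "sat M e S \<psi> = sat M e' S \<psi>"
    if "\<forall>i<max n m. e i = e' i" for e e' S
    using that n[rule_format, of e e' S] m[rule_format, of e e' S] by simp_all
  then show ?case by (intro exI[of _ "max n m"] allI impI) (simp only: sat.simps)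
next
  case (AllN x \<phi>)
  then obtain n where n: "\<forall>e e' S. (\<forall>i<n. e i = e' i) \<longrightarrow> sat M e S \<phi> = sat M e' S \<phi>" by blast
  have "sat M (e(x := a)) S \<phi> = sat M (e'(x := a)) S \<phi>" if "\<forall>i<n. e i = e' i" for e e' S a
    using that n[rule_format, of "e(x := a)" "e'(x := a)"] by simp
  then show ?case by (intro exI[of _ n] allI impI) (simp only: sat.simps)
next
  case (ExN x \<phi>)
  then obtain n where n: "\<forall>e e' S. (\<forall>i<n. e i = e' i) \<longrightarrow> sat M e S \<phi> = sat M e' S \<phi>" by blast
  have "sat M (e(x := a)) S \<phi> = sat M (e'(x := a)) S \<phi>" if "\<forall>i<n. e i = e' i" for e e' S a
    using that n[rule_format, of "e(x := a)" "e'(x := a)"] by simp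
  then show ?case by (intro exI[of _ n] allI impI) (simp only: sat.simps)
next
  case (AllS X \<phi>)
  then obtain n where n: "\<forall>e e' S. (\<forall>i<n. e i = e' i) \<longrightarrow> sat M e S \<phi> = sat M e' S \<phi>" by blast
  have "sat M e (S(X := A)) \<phi> = sat M e' (S(X := A)) \<phi>" if "\<forall>i<n. e i = e' i" for e e' S A
    using that n[rule_format, of e e'] by simp
  then show ?case by (intro exI[of _ n] allI impI) (simp only: sat.simps)
next
  case (ExS X \<phi>)
  then obtain n where n: "\<forall>e e' S. (\<forall>i<n. e i = e' i) \<longrightarrow> sat M e S \<phi> = sat M e' S \<phi>" by blast
  have "sat M e (S(X := A)) \<phi> = sat M e' (S(X := A)) \<phi>" if "\<forall>i<n. e i = e' i" for e e' S A
    using that n[rule_format, of e e'] by simp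
  then show ?case by (intro exI[of _ n] allI impI) (simp only: sat.simps)
qed

section \<open>Tuple codes and their bounded decoding\<close>

definition pair_tm :: "tm \<Rightarrow> tm \<Rightarrow> tm" where
  "pair_tm s t = Add (Mul (Add s t) (Add s t)) s"

primrec tuple_tm :: "nat \<Rightarrow> (nat \<Rightarrow> tm) \<Rightarrow> tm" where
  "tuple_tm 0 \<sigma> = Const0"
| "tuple_tm (Suc n) \<sigma> = pair_tm (tuple_tm n \<sigma>) (\<sigma> n)"

primrec tuple_code :: "('a, 'm) l2_structure_scheme \<Rightarrow> nat \<Rightarrow> (nat \<Rightarrow> 'a) \<Rightarrow> 'a" where
  "tuple_code M 0 e = \<zero>\<^bsub>M\<^esub>"
| "tuple_code M (Suc n) e = pair_code M (tuple_code M n e) (e n)"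

text \<open>Components of a tuple never exceed its code, so one bound, read from the variable
  \<open>b\<close> that holds the code, serves for all of them. For \<open>k \<le> b\<close> the
  variable \<open>b\<close> is not itself quantified.\<close>

primrec bounded_exs :: "nat \<Rightarrow> nat \<Rightarrow> fm \<Rightarrow> fm" where
  "bounded_exs b 0 \<theta> = \<theta>"
| "bounded_exs b (Suc k) \<theta> =
     ExN k (Conj (LessF (Var k) (Add (Var b) Const1)) (bounded_exs b k \<theta>))"

lemma tm_val_pair_tm [simp]: "tm_val M e (pair_tm s t) = pair_code M (tm_val M e s) (tm_val M e t)"
  by (simp add: pair_tm_def pair_code_def)

lemma tm_val_tuple_tm [simp]:
  "tm_val M e (tuple_tm n \<sigma>) = tuple_code M n (\<lambda>i. tm_val M e (\<sigma> i))"
  by (induction n) simp_all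

lemma tuple_code_cong:
  "(\<And>i. i < n \<Longrightarrow> e i = e' i) \<Longrightarrow> tuple_code M n e = tuple_code M n e'"
  by (induction n) simp_all

lemma bounded_bounded_exs: "bounded_fm \<theta> \<Longrightarrow> k \<le> b \<Longrightarrow> bounded_fm (bounded_exs b k \<theta>)"
  by (induction k) (auto intro!: bounded_fm.intros)

lemma sat_bounded_exs:
  "k \<le> b \<Longrightarrow> sat M e S (bounded_exs b k \<theta>) \<longleftrightarrow>
     (\<exists>e'. (\<forall>i<k. e' i \<prec>\<^bsub>M\<^esub> e b \<oplus>\<^bsub>M\<^esub> \<one>\<^bsub>M\<^esub>) \<and> (\<forall>i\<ge>k. e' i = e i) \<and> sat M e' S \<theta>)"
proof (induction k arbitrary: e)
  case 0
  have "e' = e" if "\<forall>i\<ge>0. e' i = e i" for e'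
    using that by auto
  then show ?case by auto
next
  case (Suc k)
  \<comment> \<open>The value chosen by the outermost quantifier can be read off as
    \<open>e' k\<close>, so the quantifiers over \<open>a\<close> and \<open>e'\<close> merge into
    one.\<close>
  have *: "(\<exists>a. a \<prec>\<^bsub>M\<^esub> e b \<oplus>\<^bsub>M\<^esub> \<one>\<^bsub>M\<^esub> \<and> (\<forall>i<k. e' i \<prec>\<^bsub>M\<^esub> e b \<oplus>\<^bsub>M\<^esub> \<one>\<^bsub>M\<^esub>) \<and>
          (\<forall>i\<ge>k. e' i = (e(k := a)) i) \<and> sat M e' S \<theta>) \<longleftrightarrow>
        (\<forall>i<Suc k. e' i \<prec>\<^bsub>M\<^esub> e b \<oplus>\<^bsub>M\<^esub> \<one>\<^bsub>M\<^esub>) \<and> (\<forall>i\<ge>Suc k. e' i = e i) \<and> sat M e' S \<theta>"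
    (is "?l \<longleftrightarrow> ?r") for e'
  proof
    assume ?l
    then show ?r by (auto simp: less_Suc_eq)
  next
    assume r: ?r
    then show ?l by (intro exI[of _ "e' k"]) (auto simp: le_Suc_eq Suc_le_eq)
  qed
  have "(e(k := a)) b = e b" for a using Suc.prems by simp
  then have "sat M e S (bounded_exs b (Suc k) \<theta>) \<longleftrightarrow>
      (\<exists>a. a \<prec>\<^bsub>M\<^esub> e b \<oplus>\<^bsub>M\<^esub> \<one>\<^bsub>M\<^esub> \<and> (\<exists>e'. (\<forall>i<k. e' i \<prec>\<^bsub>M\<^esub> e b \<oplus>\<^bsub>M\<^esub> \<one>\<^bsub>M\<^esub>) \<and>
          (\<forall>i\<ge>k. e' i = (e(k := a)) i) \<and> sat M e' S \<theta>))"
    using Suc.IH[of "e(k := _)"] Suc.prems by (simp del: fun_upd_apply add: fun_upd_same)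
  also have "\<dots> \<longleftrightarrow> (\<exists>e' a. a \<prec>\<^bsub>M\<^esub> e b \<oplus>\<^bsub>M\<^esub> \<one>\<^bsub>M\<^esub> \<and> (\<forall>i<k. e' i \<prec>\<^bsub>M\<^esub> e b \<oplus>\<^bsub>M\<^esub> \<one>\<^bsub>M\<^esub>) \<and>
          (\<forall>i\<ge>k. e' i = (e(k := a)) i) \<and> sat M e' S \<theta>)"
    by (iprover)
  finally show ?case unfolding * .
qed

abbreviation env_cons :: "'a \<Rightarrow> (nat \<Rightarrow> 'a) \<Rightarrow> nat \<Rightarrow> 'a"  (infixr \<open>##\<close> 65) where
  "a ## e \<equiv> case_nat a e"

locale rca0_model =
  fixes M :: "('a, 'm) l2_structure_scheme" (structure)
  assumes rca0: "RCA0 M"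
begin

sublocale ordered_semiring_structure M
  using rca0 by unfold_locales (simp add: RCA0_def)

lemma tuple_inject: "tuple_code M n e = tuple_code M n e' \<Longrightarrow> i < n \<Longrightarrow> e i = e' i"
  by (induction n) (auto simp: less_Suc_eq)

lemma leq_tuple: "i < n \<Longrightarrow> e i \<preceq> tuple_code M n e"
proof (induction n)
  case (Suc n)
  show ?case
  proof (cases "i = n")
    case False
    with Suc have "e i \<preceq> tuple_code M n e" by simp
    also have "\<dots> \<preceq> tuple_code M (Suc n) e" by simp
    finally show ?thesis .
  qed simp
qed simp

text \<open>
  Predicates and terms are functions of a de Bruijn environment \<open>e\<close>: under a quantifier the bound
  number is \<open>e 0\<close> and the outer environment is \<open>\<lambda>i. e (Suc i)\<close>. This makes the closure rules below
  applicable to ordinary HOL formulas by resolution.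
\<close>

definition definable_term :: "((nat \<Rightarrow> 'a) \<Rightarrow> 'a) \<Rightarrow> bool" where
  "definable_term t \<longleftrightarrow> (\<exists>\<tau>. \<forall>e. tm_val M e \<tau> = t e)"

definition decidable :: "((nat \<Rightarrow> 'a) \<Rightarrow> bool) \<Rightarrow> bool" where
  "decidable P \<longleftrightarrow>
     (\<exists>\<theta> S. bounded_fm \<theta> \<and> range S \<subseteq> Sets M \<and> (\<forall>e. sat M e S \<theta> \<longleftrightarrow> P e))"

lemma decidableI:
  "bounded_fm \<theta> \<Longrightarrow> range S \<subseteq> Sets M \<Longrightarrow> (\<And>e. sat M e S \<theta> \<longleftrightarrow> P e) \<Longrightarrow> decidable P"
  unfolding decidable_def by blast

lemma
  shows term_var: "definable_term (\<lambda>e. e i)"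
    and term_zero: "definable_term (\<lambda>e. \<zero>)"
    and term_one: "definable_term (\<lambda>e. \<one>)"
  unfolding definable_term_def using tm_val.simps by metis+

lemma
  assumes "definable_term s" "definable_term t"
  shows term_plus: "definable_term (\<lambda>e. s e \<oplus> t e)"
    and term_times: "definable_term (\<lambda>e. s e \<otimes> t e)"
    and term_pair: "definable_term (\<lambda>e. pair_code M (s e) (t e))"
  using assms unfolding definable_term_def by (metis tm_val.simps tm_val_pair_tm)+

lemma ex_Set: "\<exists>A. A \<in> Sets M"
  using rca0 by (auto simp: RCA0_def)

text \<open>A vacuous quantifier over the variable \<open>n\<close>, on which
  \<open>\<theta>\<close> does not depend, presents \<open>\<theta>\<close> both as a
  \<open>\<Sigma>\<^sup>0\<^sub>1\<close> and as a \<open>\<Pi>\<^sup>0\<^sub>1\<close>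
  formula.\<close>

lemma bounded_comprehension:
  assumes \<theta>: "bounded_fm \<theta>" and S: "range S \<subseteq> Sets M"
  shows "{a. sat M (e(x := a)) S \<theta>} \<in> Sets M"
proof -
  obtain n where n: "\<forall>e e' S. (\<forall>i<n. e i = e' i) \<longrightarrow> sat M e S \<theta> = sat M e' S \<theta>"
    using sat_cong by blast
  have [simp]: "sat M (e(n := b)) S \<theta> = sat M e S \<theta>" for e b
    using n[rule_format, of "e(n := b)" e] by simp
  have "Sigma01 (ExN n \<theta>)" "Pi01 (AllN n \<theta>)"
    using \<theta> by (auto simp: Sigma01_def Pi01_def)
  moreover have "\<forall>a. sat M (e(x := a)) S (ExN n \<theta>) \<longleftrightarrow> sat M (e(x := a)) S (AllN n \<theta>)"
    by simp
  ultimately obtain A where "A \<in> Sets M" "\<forall>a. a \<in> A \<longleftrightarrow> sat M (e(x := a)) S (ExN n \<theta>)"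
    using S rca0 unfolding RCA0_def Delta01_comprehension_def by blast
  then show ?thesis by (auto simp: set_eq_iff elim!: back_subst[of "\<lambda>A. A \<in> Sets M"])
qed

text \<open>\<open>A\<close> collects the codes of satisfying tuples; decoding needs only
  quantifiers bounded by the code. Injectivity of codes together with \<open>cong\<close> makes the
  choice of decoded tuple irrelevant.\<close>

lemma decidable_tuple_code:
  assumes "decidable P" and cong: "\<And>e e'. (\<And>i. i < n \<Longrightarrow> e i = e' i) \<Longrightarrow> P e = P e'"
  shows "\<exists>A\<in>Sets M. \<forall>e. P e \<longleftrightarrow> tuple_code M n e \<in> A"
proof -
  obtain \<theta> S where \<theta>: "bounded_fm \<theta>" and S: "range S \<subseteq> Sets M" and P: "\<And>e. sat M e S \<theta> \<longleftrightarrow> P e"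
    using assms(1) unfolding decidable_def by blast
  define \<psi> where "\<psi> = bounded_exs n n (Conj (EqF (Var n) (tuple_tm n Var)) \<theta>)"
  define A where "A = {z. sat M ((\<lambda>_. \<zero>)(n := z)) S \<psi>}"
  have "A \<in> Sets M"
    unfolding A_def \<psi>_def using \<theta> S
    by (intro bounded_comprehension bounded_bounded_exs bounded_fm.intros) auto
  moreover have "P e \<longleftrightarrow> tuple_code M n e \<in> A" for e
  proof
    assume "P e"
    \<comment> \<open>From \<open>n\<close> on, the witness must coincide with the environment used
      in \<open>A\<close>, since \<open>bounded_exs\<close> changes only the values below
      \<open>n\<close>.\<close>
    let ?e = "\<lambda>i. if i < n then e i else ((\<lambda>_. \<zero>)(n := tuple_code M n e)) i"
    have "sat M ?e S \<theta>"
      using \<open>P e\<close> P cong[of e ?e] by auto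
    moreover have "tuple_code M n ?e = tuple_code M n e"
      by (rule tuple_code_cong) simp
    ultimately show "tuple_code M n e \<in> A"
      using leq_tuple[of _ n e]
      by (auto simp: A_def \<psi>_def sat_bounded_exs prec_succ_iff intro!: exI[of _ ?e])
  next
    assume "tuple_code M n e \<in> A"
    then obtain e' where e': "tuple_code M n e = tuple_code M n e'" "sat M e' S \<theta>"
      by (auto simp: A_def \<psi>_def sat_bounded_exs)
    then show "P e"
      using P cong[of e e', OF tuple_inject[OF e'(1)]] by simp
  qed
  ultimately show ?thesis by blast
qed

lemma decidable_tuple:
  assumes "decidable P"
  shows "\<exists>n. \<exists>A\<in>Sets M. \<forall>e. P e \<longleftrightarrow> tuple_code M n e \<in> A"
proof -
  obtain \<theta> S where P: "\<And>e. sat M e S \<theta> \<longleftrightarrow> P e"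
    using assms unfolding decidable_def by blast
  obtain n where "\<forall>e e' S. (\<forall>i<n. e i = e' i) \<longrightarrow> sat M e S \<theta> = sat M e' S \<theta>"
    using sat_cong by blast
  then have "P e = P e'" if "\<And>i. i < n \<Longrightarrow> e i = e' i" for e e'
    using that P[of e] P[of e'] by blast
  from decidable_tuple_code[OF assms this] show ?thesis by blast
qed

text \<open>
  Since every decidable predicate is membership of a tuple code in a single set, predicates
  with different set parameters can be combined without renaming variables.
\<close>

lemma decidable_subst:
  assumes "decidable P" "\<And>i. definable_term (\<sigma> i)"
  shows "decidable (\<lambda>e. P (\<lambda>i. \<sigma> i e))"
proof -
  obtain n A where A: "A \<in> Sets M" "\<And>e. P e \<longleftrightarrow> tuple_code M n e \<in> A"
    using decidable_tuple[OF assms(1)] by blast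
  obtain \<tau> where \<tau>: "\<And>i e. tm_val M e (\<tau> i) = \<sigma> i e"
    using assms(2) unfolding definable_term_def by metis
  show ?thesis
    by (rule decidableI[of "MemF (tuple_tm n \<tau>) 0" "\<lambda>_. A"]) (auto simp: A \<tau> bounded_fm.intros)
qed

section \<open>Closure properties of decidable predicates\<close>

lemma
  assumes "definable_term s" "definable_term t"
  shows decidable_eq: "decidable (\<lambda>e. s e = t e)"
    and decidable_prec: "decidable (\<lambda>e. s e \<prec> t e)"
proof -
  obtain \<sigma> \<tau> where *: "\<And>e. tm_val M e \<sigma> = s e" "\<And>e. tm_val M e \<tau> = t e"
    using assms unfolding definable_term_def by blast
  obtain A where A: "A \<in> Sets M" using ex_Set by blast
  show "decidable (\<lambda>e. s e = t e)"
    by (rule decidableI[of "EqF \<sigma> \<tau>" "\<lambda>_. A"]) (auto simp: A * bounded_fm.intros)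
  show "decidable (\<lambda>e. s e \<prec> t e)"
    by (rule decidableI[of "LessF \<sigma> \<tau>" "\<lambda>_. A"]) (auto simp: A * bounded_fm.intros)
qed

lemma decidable_mem:
  assumes "definable_term t" "A \<in> Sets M"
  shows "decidable (\<lambda>e. t e \<in> A)"
proof -
  obtain \<tau> where "\<And>e. tm_val M e \<tau> = t e"
    using assms unfolding definable_term_def by blast
  then show ?thesis
    by (intro decidableI[of "MemF \<tau> 0" "\<lambda>_. A"]) (auto simp: assms bounded_fm.intros)
qed

lemma decidable_not: "decidable P \<Longrightarrow> decidable (\<lambda>e. \<not> P e)"
  unfolding decidable_def by (metis bounded_fm.intros(4) sat.simps(4))

lemma
  assumes "decidable P" "decidable Q"
  shows decidable_conj: "decidable (\<lambda>e. P e \<and> Q e)"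
    and decidable_disj: "decidable (\<lambda>e. P e \<or> Q e)"
    and decidable_imp: "decidable (\<lambda>e. P e \<longrightarrow> Q e)"
    and decidable_iff: "decidable (\<lambda>e. P e \<longleftrightarrow> Q e)"
proof -
  obtain n A m B where *: "A \<in> Sets M" "\<And>e. P e \<longleftrightarrow> tuple_code M n e \<in> A"
    "B \<in> Sets M" "\<And>e. Q e \<longleftrightarrow> tuple_code M m e \<in> B"
    using assms[THEN decidable_tuple] by blast
  let ?P = "MemF (tuple_tm n Var) 0" and ?Q = "MemF (tuple_tm m Var) (Suc 0)"
  have S: "range (A ## (\<lambda>_. B)) \<subseteq> Sets M"
    using * by (auto split: nat.splits)
  show conj: "decidable (\<lambda>e. P e \<and> Q e)"
    by (rule decidableI[of "Conj ?P ?Q", OF _ S]) (auto simp: * bounded_fm.intros)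
  show "decidable (\<lambda>e. P e \<or> Q e)"
    by (rule decidableI[of "Disj ?P ?Q", OF _ S]) (auto simp: * bounded_fm.intros)
  show "decidable (\<lambda>e. P e \<longrightarrow> Q e)"
    by (rule decidableI[of "Impl ?P ?Q", OF _ S]) (auto simp: * bounded_fm.intros)
  show "decidable (\<lambda>e. P e \<longleftrightarrow> Q e)"
    by (rule decidableI[of "Conj (Impl ?P ?Q) (Impl ?Q ?P)", OF _ S])
      (auto simp: * bounded_fm.intros)
qed

lemma
  assumes "definable_term t" and P: "decidable (\<lambda>e. P (e 0) (\<lambda>i. e (Suc i)))"
  shows decidable_bex: "decidable (\<lambda>e. \<exists>a. a \<prec> t e \<and> P a e)"
    and decidable_ball: "decidable (\<lambda>e. \<forall>a. a \<prec> t e \<longrightarrow> P a e)"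
proof -
  obtain n A where A: "A \<in> Sets M" "\<And>e. P (e 0) (\<lambda>i. e (Suc i)) \<longleftrightarrow> tuple_code M n e \<in> A"
    using decidable_tuple[OF P] by blast
  obtain \<tau> where \<tau>: "\<And>e. tm_val M e \<tau> = t e"
    using assms unfolding definable_term_def by blast
  \<comment> \<open>Beyond \<open>n\<close>, updating \<open>y\<close> leaves the outer components
    of the tuple alone; outside \<open>\<tau>\<close>, it leaves the bound alone, as
    \<open>bounded_fm\<close> requires.\<close>
  obtain y where y: "y \<ge> n" "y \<notin> tm_vars \<tau>"
    using finite_tm_vars[of \<tau>] finite_nat_set_iff_bounded[of "tm_vars \<tau>"]
    by (metis linorder_not_le max.cobounded1 max.cobounded2)
  define \<mu> where "\<mu> = MemF (tuple_tm n (Var y ## Var)) 0"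
  have \<mu>: "sat M (e(y := a)) (\<lambda>_. A) \<mu> \<longleftrightarrow> P a e" for e a
  proof -
    have "tuple_code M n (\<lambda>i. tm_val M (e(y := a)) ((Var y ## Var) i)) = tuple_code M n (a ## e)"
      using y by (intro tuple_code_cong) (auto split: nat.splits)
    then show ?thesis using A(2)[of "a ## e"] by (simp add: \<mu>_def)
  qed
  have "tm_val M (e(y := a)) \<tau> = tm_val M e \<tau>" for e a
    using y by (intro tm_val_cong) auto
  then have [simp]: "t (e(y := a)) = t e" for e a
    using \<tau> by simp
  have "bounded_fm \<mu>" by (simp add: \<mu>_def bounded_fm.intros)
  then have bex: "bounded_fm (ExN y (Conj (LessF (Var y) \<tau>) \<mu>))"
    and ball: "bounded_fm (AllN y (Impl (LessF (Var y) \<tau>) \<mu>))"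
    using y by (auto intro: bounded_fm.intros)
  have S: "range (\<lambda>_. A) \<subseteq> Sets M" using A by simp
  show "decidable (\<lambda>e. \<exists>a. a \<prec> t e \<and> P a e)"
    by (rule decidableI[OF bex S]) (simp add: \<mu> \<tau>)
  show "decidable (\<lambda>e. \<forall>a. a \<prec> t e \<longrightarrow> P a e)"
    by (rule decidableI[OF ball S]) (simp add: \<mu> \<tau>)
qed

lemma decidable_const: "decidable (\<lambda>e. b)"
proof (cases b)
  case True
  then show ?thesis using decidable_eq[OF term_zero term_zero] by simp
next
  case False
  then show ?thesis using decidable_prec[OF term_zero term_zero] by simp
qed

lemma decidable_leq:
  "definable_term s \<Longrightarrow> definable_term t \<Longrightarrow> decidable (\<lambda>e. s e \<preceq> t e)"
  unfolding leq_def by (intro decidable_disj decidable_prec decidable_eq)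

lemmas term_intros = term_var term_zero term_one term_plus term_times term_pair

lemma term_shift: "definable_term t \<Longrightarrow> definable_term (\<lambda>e. t (\<lambda>i. e (Suc i)))"
proof -
  assume "definable_term t"
  then obtain \<tau> where \<tau>: "\<And>e. tm_val M e \<tau> = t e"
    unfolding definable_term_def by blast
  have "\<exists>\<tau>'. \<forall>e. tm_val M e \<tau>' = tm_val M (\<lambda>i. e (Suc i)) \<tau>"
    by (induction \<tau>) (metis tm_val.simps)+
  with \<tau> show ?thesis unfolding definable_term_def by simp
qed

lemma decidable_divs:
  "definable_term s \<Longrightarrow> definable_term t \<Longrightarrow> decidable (\<lambda>e. s e divs t e)"
  unfolding divs_bounded
  by (intro decidable_bex decidable_conj decidable_eq term_intros term_shift)

lemmas decidable_intros =
  decidable_bex decidable_ball decidable_conj decidable_disj decidable_imp decidable_iff decidable_not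
  decidable_eq decidable_prec decidable_leq decidable_divs decidable_mem term_intros

section \<open>The axiom schemes restated for decidable predicates\<close>

lemma comprehension: "decidable P \<Longrightarrow> {a. P (a ## p)} \<in> Sets M"
proof -
  assume "decidable P"
  then obtain \<theta> S where *: "bounded_fm \<theta>" "range S \<subseteq> Sets M" "\<And>e. sat M e S \<theta> \<longleftrightarrow> P e"
    unfolding decidable_def by blast
  have "(\<zero> ## p)(0 := a) = a ## p" for a
    by (auto split: nat.splits)
  then show ?thesis
    using bounded_comprehension[OF *(1,2), of "\<zero> ## p" 0] * by simp
qed

lemma Delta_comprehension:
  assumes "decidable P" "decidable Q"
    and eq: "\<And>a. (\<exists>b. P (b ## a ## p)) \<longleftrightarrow> (\<forall>b. Q (b ## a ## p))"
  shows "{a. \<exists>b. P (b ## a ## p)} \<in> Sets M"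
proof -
  obtain n A m B where *: "A \<in> Sets M" "\<And>e. P e \<longleftrightarrow> tuple_code M n e \<in> A"
    "B \<in> Sets M" "\<And>e. Q e \<longleftrightarrow> tuple_code M m e \<in> B"
    using assms(1,2)[THEN decidable_tuple] by blast
  \<comment> \<open>Variable \<open>0\<close> holds the witness, variable \<open>Suc 0\<close> the
    element tested for membership, and the later ones the parameters.\<close>
  let ?S = "A ## (\<lambda>_. B)" and ?e = "\<zero> ## \<zero> ## p"
  let ?P = "ExN 0 (MemF (tuple_tm n Var) 0)" and ?Q = "AllN 0 (MemF (tuple_tm m Var) (Suc 0))"
  have e: "?e(Suc 0 := a, 0 := b) = b ## a ## p" for a b
    by (auto split: nat.splits)
  have "Sigma01 ?P" "Pi01 ?Q"
    unfolding Sigma01_def Pi01_def using bounded_fm.intros(3) by blast+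
  moreover have "range ?S \<subseteq> Sets M"
    using * by (auto split: nat.splits)
  moreover have "\<forall>a. sat M (?e(Suc 0 := a)) ?S ?P \<longleftrightarrow> sat M (?e(Suc 0 := a)) ?S ?Q"
    using eq by (simp add: e * del: fun_upd_apply)
  ultimately obtain C where "C \<in> Sets M" "\<forall>a. a \<in> C \<longleftrightarrow> sat M (?e(Suc 0 := a)) ?S ?P"
    using rca0 unfolding RCA0_def Delta01_comprehension_def by blast
  moreover from this have "C = {a. \<exists>b. P (b ## a ## p)}"
    by (auto simp add: e * simp del: fun_upd_apply)
  ultimately show ?thesis by simp
qed

lemma Sigma_induction:
  assumes "decidable P"
    and "\<exists>b. P (b ## \<zero> ## p)"
    and "\<And>a. \<exists>b. P (b ## a ## p) \<Longrightarrow> \<exists>b. P (b ## (a \<oplus> \<one>) ## p)"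
  shows "\<exists>b. P (b ## a ## p)"
proof -
  obtain \<theta> S where *: "bounded_fm \<theta>" "range S \<subseteq> Sets M" "\<And>e. sat M e S \<theta> \<longleftrightarrow> P e"
    using assms unfolding decidable_def by blast
  let ?e = "\<zero> ## \<zero> ## p"
  have e: "?e(Suc 0 := a, 0 := b) = b ## a ## p" for a b
    by (auto split: nat.splits)
  have "Sigma01 (ExN 0 \<theta>)" using * unfolding Sigma01_def by blast
  moreover have sat: "sat M (?e(Suc 0 := a)) S (ExN 0 \<theta>) \<longleftrightarrow> (\<exists>b. P (b ## a ## p))" for a
    by (simp add: e * del: fun_upd_apply)
  ultimately have "\<forall>a. sat M (?e(Suc 0 := a)) S (ExN 0 \<theta>)"
    using rca0 *(2) assms(2,3) unfolding RCA0_def Sigma01_induction_def by metis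
  then show ?thesis using sat by blast
qed

end

section \<open>Induction, coding and bounding\<close>

context rca0_model
begin

lemma decidable_shift: "decidable P \<Longrightarrow> decidable (\<lambda>e. P (\<lambda>i. e (Suc i)))"
  using decidable_subst[of P "\<lambda>i e. e (Suc i)"] term_var by blast

lemma definable_cons:
  assumes "definable_term t" "\<And>i. definable_term (\<lambda>e. f e i)"
  shows "definable_term (\<lambda>e. (t e ## f e) i)"
  using assms by (cases i) auto

lemma decidable_cons2:
  assumes "decidable P"
  shows "decidable (\<lambda>e. P (e i ## e j ## (\<lambda>l. e (g l))))"
  using decidable_subst[OF assms, of "\<lambda>l e. (e i ## e j ## (\<lambda>l. e (g l))) l"]
  by (simp add: definable_cons term_intros)

text \<open>Without a least \<open>c\<close>, the statement that all \<open>d \<prec> a\<close> have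
  counterexamples below one common bound would pass from \<open>a\<close> to
  \<open>a \<oplus> \<one>\<close>. The common bound is what makes this statement
  \<open>\<Sigma>\<^sup>0\<^sub>1\<close>, so that induction applies.\<close>

lemma Pi_least:
  assumes P: "decidable P" and c: "\<forall>b. P (b ## c ## p)"
  shows "\<exists>c. (\<forall>b. P (b ## c ## p)) \<and> (\<forall>d. d \<prec> c \<longrightarrow> \<not> (\<forall>b. P (b ## d ## p)))"
proof (rule ccontr)
  assume no: "\<not> ?thesis"
  let ?Q = "\<lambda>e. \<forall>d. d \<prec> e (Suc 0) \<longrightarrow> (\<exists>b. b \<prec> e 0 \<and> \<not> P (b ## d ## (\<lambda>i. e (Suc (Suc i)))))"
  have Q: "decidable ?Q"
    by (intro decidable_intros decidable_cons2[OF P])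
  have "\<exists>B. ?Q (B ## (c \<oplus> \<one>) ## p)"
  proof (rule Sigma_induction[OF Q], goal_cases)
    case 1
    then show ?case by simp
  next
    case (2 a)
    then obtain B where B: "\<And>d. d \<prec> a \<Longrightarrow> \<exists>b. b \<prec> B \<and> \<not> P (b ## d ## p)" by auto
    then obtain b where b: "\<not> P (b ## a ## p)" using no by blast
    have "\<exists>b'. b' \<prec> N.max B (b \<oplus> \<one>) \<and> \<not> P (b' ## d ## p)" if "d \<prec> a \<oplus> \<one>" for d
      using B b that unfolding prec_succ_cases N.less_max_iff_disj by blast
    then show ?case by (intro exI[of _ "N.max B (b \<oplus> \<one>)"]) simp
  qed
  then show False using c by (auto simp: prec_succ_iff)
qed

lemma strong_induction:
  assumes P: "decidable P" and step: "\<And>a. (\<And>d. d \<prec> a \<Longrightarrow> P (d ## p)) \<Longrightarrow> P (a ## p)"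
  shows "P (a ## p)"
proof (rule ccontr)
  assume "\<not> P (a ## p)"
  then obtain c where "\<not> P (c ## p)" "\<And>d. d \<prec> c \<Longrightarrow> P (d ## p)"
    using Pi_least[OF decidable_not[OF decidable_shift[OF P]], of a p] by auto
  with step show False by blast
qed

lemma induction:
  assumes P: "decidable P" and "P (\<zero> ## p)" and "\<And>a. P (a ## p) \<Longrightarrow> P ((a \<oplus> \<one>) ## p)"
  shows "P (a ## p)"
  using Sigma_induction[OF decidable_shift[OF P], of p a] assms(2,3) by simp

text \<open>Stands in for factorials and products: \<open>k = \<one>\<close> gives a multiple of all
  positive numbers up to \<open>n\<close>, other \<open>k\<close> a common multiple of the coding
  moduli. The induction multiplies in one modulus at a time.\<close>

lemma common_multiple: "\<exists>c. c \<noteq> \<zero> \<and> (\<forall>x. x \<prec> n \<longrightarrow> (\<one> \<oplus> x \<otimes> k) divs c)"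
proof -
  let ?P = "\<lambda>e. e 0 \<noteq> \<zero> \<and> (\<forall>x. x \<prec> e (Suc 0) \<longrightarrow> (\<one> \<oplus> x \<otimes> e (Suc (Suc 0))) divs e 0)"
  have P: "decidable ?P" by (intro decidable_intros)
  have "\<exists>c. ?P (c ## n ## (\<lambda>_. k))"
  proof (rule Sigma_induction[OF P], goal_cases)
    case 1
    then show ?case by (intro exI[of _ "\<one>"]) simp
  next
    case (2 a)
    then obtain c where c: "c \<noteq> \<zero>" "\<And>x. x \<prec> a \<Longrightarrow> (\<one> \<oplus> x \<otimes> k) divs c" by auto
    have "\<one> \<oplus> a \<otimes> k \<noteq> \<zero>"
      by (metis N.zero_less_one leq_plus not_leq)
    with c show ?case
      by (intro exI[of _ "c \<otimes> (\<one> \<oplus> a \<otimes> k)"]) (auto simp: prec_succ_cases intro: N.dvd_mult2)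
  qed
  then show ?thesis by simp
qed

text \<open>These are the moduli of Goedel's beta function. The shift to
  \<open>x \<oplus> \<one>\<close> keeps the modulus of \<open>\<zero>\<close> from being
  \<open>\<one>\<close>, which would divide every \<open>c\<close>.\<close>

definition coded :: "'a \<Rightarrow> 'a \<Rightarrow> 'a \<Rightarrow> bool" where
  "coded c m x \<longleftrightarrow> (\<one> \<oplus> (x \<oplus> \<one>) \<otimes> m) divs c"

lemma decidable_coded:
  "definable_term s \<Longrightarrow> definable_term t \<Longrightarrow> definable_term u \<Longrightarrow>
     decidable (\<lambda>e. coded (s e) (t e) (u e))"
  unfolding coded_def by (intro decidable_intros)

text \<open>
  The least nonzero common multiple \<open>c\<close> of the moduli belonging to the set to be coded has no
  superfluous modulus as a divisor, since such a divisor could be cancelled.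
\<close>

lemma Sigma_coding:
  assumes P: "decidable P"
  shows "\<exists>c m. \<forall>x. x \<prec> n \<longrightarrow> (coded c m x \<longleftrightarrow> (\<exists>s. P (s ## x ## p)))"
proof -
  \<comment> \<open>Any difference of two distinct numbers below \<open>n\<close> divides
    \<open>m\<close>, so the corresponding moduli are coprime.\<close>
  obtain m where m0: "m \<noteq> \<zero>" and m: "\<And>x. x \<prec> n \<Longrightarrow> (x \<oplus> \<one>) divs m"
    using common_multiple[of n "\<one>"] by (auto simp: N.add.commute)
  obtain C where C: "C \<noteq> \<zero>" "\<And>x. x \<prec> n \<Longrightarrow> coded C m x"
    using common_multiple[of "n \<oplus> \<one>" m] by (auto simp: coded_def)
  have coprime: "coded d m x" if c: "coded ((\<one> \<oplus> (y \<oplus> \<one>) \<otimes> m) \<otimes> d) m x"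
    and xy: "x \<prec> n" "y \<prec> n" "x \<noteq> y" for d x y
  proof -
    obtain t where t: "y = x \<oplus> t \<or> x = y \<oplus> t"
      using N.linear[of x y] unfolding leq_iff by blast
    then have "t \<noteq> \<zero>" using xy by auto
    then obtain t' where t': "t = t' \<oplus> \<one>"
      using one_least[of t] zero_least[of t] leq_iff[of "\<one>" t]
      by (auto simp: leq_def N.add.commute)
    have "t' \<prec> t" using t' prec_succ_iff by simp
    moreover have "t \<preceq> x \<or> t \<preceq> y" using t by auto
    ultimately have "t' \<prec> n" using xy by (metis N.le_less_trans N.less_trans)
    then have "t divs m" using m t' by simp
    moreover have "y \<oplus> \<one> = x \<oplus> \<one> \<oplus> t \<or> x \<oplus> \<one> = y \<oplus> \<one> \<oplus> t"
      using t by (metis N.add.assoc N.add.commute)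
    ultimately show ?thesis
      using c coprime_moduli unfolding coded_def by blast
  qed
  \<comment> \<open>Quantified over all \<open>s\<close>, this is a
    \<open>\<Pi>\<^sup>0\<^sub>1\<close> property of \<open>c\<close>, although the set to be coded
    is only \<open>\<Sigma>\<^sup>0\<^sub>1\<close>; hence \<open>Pi_least\<close> is
    applicable.\<close>
  let ?Q = "\<lambda>e. e (Suc 0) \<noteq> \<zero> \<and> (\<forall>x. x \<prec> e (Suc (Suc 0)) \<longrightarrow>
      P (e 0 ## x ## (\<lambda>i. e (Suc (Suc (Suc (Suc i)))))) \<longrightarrow>
      coded (e (Suc 0)) (e (Suc (Suc (Suc 0)))) x)"
  have Q: "decidable ?Q"
    by (intro decidable_intros decidable_coded decidable_cons2[OF P])
  have "\<forall>s. ?Q (s ## C ## n ## m ## p)"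
    using C by simp
  then obtain c where c0: "c \<noteq> \<zero>"
    and c: "\<forall>s x. x \<prec> n \<longrightarrow> P (s ## x ## p) \<longrightarrow> coded c m x"
    and least: "\<forall>d. d \<prec> c \<longrightarrow> d = \<zero> \<or> (\<exists>s x. x \<prec> n \<and> P (s ## x ## p) \<and> \<not> coded d m x)"
    using Pi_least[OF Q, of C "n ## m ## p"] by auto
  have "\<exists>s. P (s ## x ## p)" if x: "x \<prec> n" "coded c m x" for x
  proof (rule ccontr)
    assume no: "\<nexists>s. P (s ## x ## p)"
    obtain d where d: "c = (\<one> \<oplus> (x \<oplus> \<one>) \<otimes> m) \<otimes> d"
      using x unfolding coded_def by (auto elim: N.dvdE)
    with c0 have d0: "d \<noteq> \<zero>" by auto
    \<comment> \<open>The cancelled modulus exceeds \<open>\<one>\<close>, so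
      \<open>d \<prec> c\<close>, and by leastness \<open>d\<close> misses some required
      \<open>y\<close>. But the modulus of \<open>y\<close> divides \<open>c\<close> and is coprime
      to that of \<open>x\<close>, so it divides \<open>d\<close>.\<close>
    have "(x \<oplus> \<one>) \<otimes> m \<noteq> \<zero>"
      using m0 prec_succ_iff[of "\<zero>" x] by (auto dest: N.less_imp_neq)
    then have "\<one> \<prec> \<one> \<oplus> (x \<oplus> \<one>) \<otimes> m"
      using zero_least[of "(x \<oplus> \<one>) \<otimes> m"] by simp
    then have "\<one> \<otimes> d \<prec> c"
      unfolding d using d0 zero_least by (intro N.mult_strict_right_mono) blast+
    then obtain y s where "y \<prec> n" "P (s ## y ## p)" "\<not> coded d m y"
      using least d0 by auto
    moreover from this have "x \<noteq> y" using no by blast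
    ultimately show False
      using c coprime[of x d y] x unfolding d by blast
  qed
  with c show ?thesis by blast
qed

text \<open>The code makes the existence of a witness decidable below \<open>n\<close>, so
  \<open>\<Sigma>\<^sup>0\<^sub>1\<close> induction can enlarge the bound one \<open>x\<close> at a
  time. The guard \<open>x \<prec> n\<close> in \<open>?Q\<close> keeps to the range where the code
  is correct.\<close>

lemma strong_bounding:
  assumes P: "decidable P"
  shows "\<exists>b. \<forall>x. x \<prec> n \<longrightarrow> (\<exists>s. P (s ## x ## p)) \<longrightarrow> (\<exists>s. s \<prec> b \<and> P (s ## x ## p))"
proof -
  obtain c m where c: "\<And>x. x \<prec> n \<Longrightarrow> coded c m x \<longleftrightarrow> (\<exists>s. P (s ## x ## p))"
    using Sigma_coding[OF P] by blast
  let ?Q = "\<lambda>e. \<forall>x. x \<prec> e (Suc 0) \<longrightarrow> x \<prec> e (Suc (Suc 0)) \<and>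
      coded (e (Suc (Suc (Suc 0)))) (e (Suc (Suc (Suc (Suc 0))))) x \<longrightarrow>
      (\<exists>s. s \<prec> e 0 \<and> P (s ## x ## (\<lambda>i. e (Suc (Suc (Suc (Suc (Suc i))))))))"
  have Q: "decidable ?Q"
    by (intro decidable_intros decidable_coded decidable_cons2[OF P])
  have "\<exists>b. ?Q (b ## n ## n ## c ## m ## p)"
  proof (rule Sigma_induction[OF Q], goal_cases)
    case 1
    then show ?case by simp
  next
    case (2 a)
    then obtain b where b: "\<And>x. x \<prec> a \<Longrightarrow> x \<prec> n \<Longrightarrow> coded c m x \<Longrightarrow> \<exists>s. s \<prec> b \<and> P (s ## x ## p)"
      by auto
    obtain s where s: "a \<prec> n \<Longrightarrow> coded c m a \<Longrightarrow> P (s ## a ## p)"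
      using c by blast
    have "\<exists>s'. s' \<prec> N.max b (s \<oplus> \<one>) \<and> P (s' ## x ## p)"
      if "x \<prec> a \<oplus> \<one>" "x \<prec> n" "coded c m x" for x
      using b s that unfolding prec_succ_cases N.less_max_iff_disj by blast
    then show ?case by (intro exI[of _ "N.max b (s \<oplus> \<one>)"]) simp
  qed
  then show ?thesis using c by auto
qed

text \<open>A pair code bounds its components, which keeps the defining predicate decidable. The
  exclusion of numbers that code no pair later places an edge set inside
  \<open>two_subsets\<close>.\<close>

lemma comprehension_pairs:
  assumes P: "decidable P"
  shows "\<exists>T\<in>Sets M. (\<forall>x y. pair_code M x y \<in> T \<longleftrightarrow> P (x ## y ## p)) \<and>
    (\<forall>z\<in>T. \<exists>x y. z = pair_code M x y)"
proof -
  let ?Q = "\<lambda>e. \<exists>x. x \<prec> e 0 \<oplus> \<one> \<and>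
      (\<exists>y. y \<prec> e 0 \<oplus> \<one> \<and> e 0 = pair_code M x y \<and> P (x ## y ## (\<lambda>i. e (Suc i))))"
  have "decidable ?Q"
    by (intro decidable_intros decidable_cons2[OF P])
  from comprehension[OF this, of p] show ?thesis
    by (rule bexI[rotated]) (auto simp: prec_succ_iff)
qed

end

section \<open>Projections\<close>

context rca0_model
begin

lemma internally_infinite_iff: "internally_infinite M A \<longleftrightarrow> (\<forall>b. \<exists>y\<in>A. b \<preceq> y)"
  unfolding internally_finite_def using N.not_less by metis

lemma UNIV_in_Sets: "UNIV \<in> Sets M"
  using comprehension[OF decidable_const[of True]] by simp

text \<open>
  A code \<open>p\<close> of \<open>(x, s)\<close> with \<open>s\<close> the least witness for \<open>x\<close> is joined to every \<open>y\<close> strictly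
  between \<open>x\<close> and \<open>p\<close>. In a solution \<open>H\<close> each \<open>p\<close> has at most one neighbour, so that for
  \<open>h \<prec> h'\<close> in \<open>H\<close> the witnesses for all \<open>x \<prec> h\<close> are bounded by \<open>h'\<close>.
\<close>

lemma RSg_locally_finite_imp_projection:
  assumes RS: "RSg_locally_finite M" and T: "T \<in> Sets M"
  shows "{x. \<exists>s. pair_code M x s \<in> T} \<in> Sets M"
proof -
  define U where "U x s \<longleftrightarrow> pair_code M x s \<in> T \<and> (\<forall>s'. s' \<prec> s \<longrightarrow> pair_code M x s' \<notin> T)" for x s
  have U_unique: "s = s'" if "U x s" "U x s'" for x s s'
    using that prec_total[of s s'] unfolding U_def by blast
  have U_ex: "\<exists>s. U x s" if "pair_code M x s \<in> T" for x s
  proof (rule ccontr)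
    assume no: "\<nexists>s. U x s"
    let ?P = "\<lambda>e. pair_code M (e (Suc 0)) (e 0) \<notin> T"
    have P: "decidable ?P" by (intro decidable_intros T)
    have "?P (s ## (\<lambda>_. x))"
      by (rule strong_induction[OF P]) (use no in \<open>auto simp: U_def\<close>)
    with that show False by simp
  qed
  let ?E = "\<lambda>e. e 0 \<prec> e (Suc 0) \<and> (\<exists>x. x \<prec> e 0 \<and> (\<exists>s. s \<prec> e (Suc 0) \<oplus> \<one> \<and>
      e (Suc 0) = pair_code M x s \<and> U x s))"
  have "decidable ?E"
    unfolding U_def by (intro decidable_intros T)
  from comprehension_pairs[OF this, of "\<lambda>_. \<zero>"]
  obtain E where E: "E \<in> Sets M" "\<forall>y p. pair_code M y p \<in> E \<longleftrightarrow> ?E (y ## p ## (\<lambda>_. \<zero>))"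
    and E_pairs: "\<forall>z\<in>E. \<exists>x y. z = pair_code M x y"
    by (elim bexE conjE) (rule that)
  have edge: "pair_code M y p \<in> E \<longleftrightarrow> y \<prec> p \<and> (\<exists>x s. x \<prec> y \<and> p = pair_code M x s \<and> U x s)" for y p
    using E(2) by (auto simp: prec_succ_iff)
  have "coded_graph M UNIV E"
    using E(1) E_pairs edge UNIV_in_Sets unfolding coded_graph_def two_subsets_def by fastforce
  moreover have "internally_infinite M UNIV"
    unfolding internally_infinite_iff by auto
  moreover have lf: "internally_finite M (nbrs M UNIV E y)" for y
  proof -
    \<comment> \<open>Neighbours of \<open>y\<close> above it code some \<open>(x, s)\<close> with
      \<open>x \<prec> y\<close>; strong bounding and uniqueness of least witnesses bound these
      \<open>s\<close> together.\<close>
    let ?Q = "\<lambda>e. U (e (Suc 0)) (e 0)"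
    have "decidable ?Q"
      unfolding U_def by (intro decidable_intros T)
    from strong_bounding[OF this, of y "\<lambda>_. \<zero>"]
    obtain b where "\<forall>x. x \<prec> y \<longrightarrow> (\<exists>s. U x s) \<longrightarrow> (\<exists>s. s \<prec> b \<and> U x s)"
      by auto
    then have b: "s \<prec> b" if "x \<prec> y" "U x s" for x s
      using that U_unique by blast
    have "p \<prec> N.max y (pair_code M y b \<oplus> \<one>)" if p: "p \<in> nbrs M UNIV E y" for p
    proof (cases "p \<prec> y")
      case True
      then show ?thesis by (simp add: N.less_max_iff_disj)
    next
      case False
      with p obtain x s where "x \<prec> y" "p = pair_code M x s" "U x s"
        by (auto simp: nbrs_def edge)
      then have "p \<preceq> pair_code M y b"
        using b pair_mono[of x y s b] by (simp add: N.less_imp_le)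
      then show ?thesis by (simp add: N.less_max_iff_disj prec_succ_iff)
    qed
    then show ?thesis unfolding internally_finite_def by blast
  qed
  ultimately obtain H where H: "RS_solution M UNIV E H"
    using RS unfolding RSg_locally_finite_def locally_finite_def by blast
  \<comment> \<open>Neighbourhoods are finite, so only the second alternative of
    \<open>RS_solution\<close> is possible.\<close>
  have unique: "h = h'" if "h \<in> H" "h' \<in> H" "h \<in> nbrs M UNIV E p" "h' \<in> nbrs M UNIV E p" for h h' p
    using H lf[of p] that unfolding RS_solution_def internally_finite_def by blast
  \<comment> \<open>Otherwise both \<open>h\<close> and \<open>h'\<close> would lie strictly between
    \<open>x\<close> and the code of \<open>(x, s)\<close>, giving that code two neighbours in
    \<open>H\<close>.\<close>
  have bound: "s \<prec> h' \<oplus> \<one>" if "h \<in> H" "h' \<in> H" "x \<prec> h" "h \<prec> h'" "U x s" for h h' x s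
  proof (rule ccontr)
    assume "\<not> s \<prec> h' \<oplus> \<one>"
    then have "h' \<prec> s" using prec_succ_iff not_leq by blast
    then have "h' \<prec> pair_code M x s" using N.less_le_trans leq_pair_snd by blast
    then have "h \<in> nbrs M UNIV E (pair_code M x s)" "h' \<in> nbrs M UNIV E (pair_code M x s)"
      using that by (auto simp: nbrs_def edge)
    then show False using unique that by blast
  qed
  have H_inf: "\<exists>h\<in>H. b \<prec> h" for b
    using H unfolding RS_solution_def internally_infinite_iff by (metis succ_leq_iff)
  have HS: "H \<in> Sets M" using H unfolding RS_solution_def by blast
  \<comment> \<open>Any two elements \<open>h \<prec> h'\<close> of \<open>H\<close> above
    \<open>x\<close> decide whether \<open>x\<close> has a witness: it suffices to search up to
    \<open>h'\<close>. Taking some such pair or all of them gives the two forms needed for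
    \<open>\<Delta>\<^sup>0\<^sub>1\<close> comprehension.\<close>
  let ?P = "\<lambda>e. \<exists>h. h \<prec> e 0 \<and> e 0 \<in> H \<and> h \<in> H \<and> e (Suc 0) \<prec> h \<and>
      (\<exists>s. s \<prec> e 0 \<oplus> \<one> \<and> pair_code M (e (Suc 0)) s \<in> T)"
  let ?Q = "\<lambda>e. \<forall>h. h \<prec> e 0 \<longrightarrow> e 0 \<in> H \<longrightarrow> h \<in> H \<longrightarrow> e (Suc 0) \<prec> h \<longrightarrow>
      (\<exists>s. s \<prec> e 0 \<oplus> \<one> \<and> pair_code M (e (Suc 0)) s \<in> T)"
  have PQ: "decidable ?P" "decidable ?Q"
    by (intro decidable_intros T HS)+
  have "(\<exists>b. ?P (b ## x ## (\<lambda>_. \<zero>))) \<longleftrightarrow> (\<exists>s. pair_code M x s \<in> T)" for x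
    using H_inf[of x] H_inf bound U_ex unfolding U_def by simp metis
  moreover have "(\<forall>b. ?Q (b ## x ## (\<lambda>_. \<zero>))) \<longleftrightarrow> (\<exists>s. pair_code M x s \<in> T)" for x
    using H_inf[of x] H_inf bound U_ex unfolding U_def by simp metis
  ultimately show ?thesis
    using Delta_comprehension[OF PQ, of "\<lambda>_. \<zero>"] by presburger
qed

end

text \<open>The meeting point of both directions: arithmetical comprehension provides this closure,
  and so does the graph theorem. Inside the locale every arithmetical predicate is
  \<open>decidable\<close>.\<close>

locale projection_closed = rca0_model +
  assumes projection: "T \<in> Sets M \<Longrightarrow> {x. \<exists>s. pair_code M x s \<in> T} \<in> Sets M"
begin

lemma decidable_ex:
  assumes P: "decidable (\<lambda>e. P (e 0) (\<lambda>i. e (Suc i)))"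
  shows "decidable (\<lambda>e. \<exists>a. P a e)"
proof -
  obtain n A where A: "\<And>e. P (e 0) (\<lambda>i. e (Suc i)) \<longleftrightarrow> tuple_code M n e \<in> A"
    using decidable_tuple[OF P] by blast
  then have PA: "P a e \<longleftrightarrow> tuple_code M n (a ## e) \<in> A" for a e
    by (metis nat.case ext)
  \<comment> \<open>\<open>Q\<close> reads the quantified number at position \<open>n\<close>
    instead of \<open>0\<close>. A tuple code of length \<open>Suc n\<close> is then the pair of the
    outer tuple and this number, the form that \<open>projection\<close> takes.\<close>
  define Q where "Q e \<longleftrightarrow> P (e n) e" for e
  have "decidable Q"
    using decidable_subst[OF P, of "\<lambda>i e. (e n ## e) i"]
    by (simp add: Q_def[abs_def] definable_cons term_intros)
  moreover have "Q e = Q e'" if "\<And>i. i < Suc n \<Longrightarrow> e i = e' i" for e e'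
  proof -
    have "tuple_code M n (e n ## e) = tuple_code M n (e' n ## e')"
      using that by (intro tuple_code_cong) (auto split: nat.splits)
    then show ?thesis by (simp add: Q_def PA)
  qed
  ultimately obtain B where B: "B \<in> Sets M" "\<And>e. Q e \<longleftrightarrow> tuple_code M (Suc n) e \<in> B"
    using decidable_tuple_code[of Q "Suc n"] by blast
  have "P a e \<longleftrightarrow> pair_code M (tuple_code M n e) a \<in> B" for a e
  proof -
    have "tuple_code M n (e(n := a)) = tuple_code M n e"
      by (rule tuple_code_cong) simp
    moreover have "tuple_code M n (a ## e(n := a)) = tuple_code M n (a ## e)"
      by (rule tuple_code_cong) (auto split: nat.splits)
    ultimately show ?thesis
      using B(2)[of "e(n := a)"] by (simp add: Q_def PA)
  qed
  then have "(\<exists>a. P a e) \<longleftrightarrow> tuple_code M n e \<in> {z. \<exists>a. pair_code M z a \<in> B}" for e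
    by simp
  then show ?thesis
    by (intro decidableI[of "MemF (tuple_tm n Var) 0" "\<lambda>_. {z. \<exists>a. pair_code M z a \<in> B}"])
      (use projection[OF B(1)] in \<open>auto intro: bounded_fm.intros\<close>)
qed

lemma decidable_all:
  assumes "decidable (\<lambda>e. P (e 0) (\<lambda>i. e (Suc i)))"
  shows "decidable (\<lambda>e. \<forall>a. P a e)"
  using decidable_not[OF decidable_ex[of "\<lambda>a e. \<not> P a e"]] decidable_not[OF assms] by simp

lemma decidable_arithmetical:
  assumes "arithmetical \<phi>" and S: "range S \<subseteq> Sets M"
  shows "decidable (\<lambda>e. sat M e S \<phi>)"
proof -
  \<comment> \<open>Translates between named variables and de Bruijn environments: updating at
    \<open>x\<close> is a substitution of terms.\<close>
  have upd: "decidable (\<lambda>e. P ((\<lambda>j. e (Suc j))(x := e 0)))" if "decidable P" for P x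
  proof -
    have "definable_term (\<lambda>e. ((\<lambda>j. e (Suc j))(x := e 0)) i)" for i
      by (cases "i = x") (simp_all add: term_intros)
    from decidable_subst[OF that this] show ?thesis .
  qed
  from assms(1) show ?thesis
  proof (induction \<phi>)
    case (EqF s t)
    show ?case by (rule decidableI[OF bounded_fm.intros(1) S]) (rule refl)
  next
    case (LessF s t)
    show ?case by (rule decidableI[OF bounded_fm.intros(2) S]) (rule refl)
  next
    case (MemF t X)
    show ?case by (rule decidableI[OF bounded_fm.intros(3) S]) (rule refl)
  next
    case (AllN x \<phi>)
    then have "decidable (\<lambda>e. sat M ((\<lambda>j. e (Suc j))(x := e 0)) S \<phi>)"
      by (intro upd) simp
    then show ?case by (simp add: decidable_all del: fun_upd_apply)
  next
    case (ExN x \<phi>)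
    then have "decidable (\<lambda>e. sat M ((\<lambda>j. e (Suc j))(x := e 0)) S \<phi>)"
      by (intro upd) simp
    then show ?case by (simp add: decidable_ex del: fun_upd_apply)
  qed (auto intro: decidable_intros)
qed

lemma arithmetical_comprehension: "arithmetical_comprehension M"
  unfolding arithmetical_comprehension_def
proof (intro allI impI)
  fix \<phi> x e and S :: "nat \<Rightarrow> 'a set"
  assume "arithmetical \<phi>" "range S \<subseteq> Sets M"
  then have "decidable (\<lambda>e. sat M e S \<phi>)" by (rule decidable_arithmetical)
  then obtain \<theta> S' where "bounded_fm \<theta>" "range S' \<subseteq> Sets M" "\<And>e. sat M e S' \<theta> \<longleftrightarrow> sat M e S \<phi>"
    unfolding decidable_def by auto
  then show "\<exists>A\<in>Sets M. \<forall>a. a \<in> A \<longleftrightarrow> sat M (e(x := a)) S \<phi>"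
    using bounded_comprehension[of \<theta> S' e x] by auto
qed

end

lemma (in rca0_model) arithmetical_comprehension_imp_projection:
  assumes "arithmetical_comprehension M" "T \<in> Sets M"
  shows "{x. \<exists>s. pair_code M x s \<in> T} \<in> Sets M"
proof -
  let ?\<phi> = "ExN 0 (MemF (pair_tm (Var 1) (Var 0)) 0)"
  have "arithmetical ?\<phi>" "range (\<lambda>_ :: nat. T) \<subseteq> Sets M"
    using assms by auto
  then have "\<exists>A\<in>Sets M. \<forall>a. a \<in> A \<longleftrightarrow> sat M ((\<lambda>_. \<zero>)(1 := a)) (\<lambda>_. T) ?\<phi>"
    by (rule assms(1)[unfolded arithmetical_comprehension_def, rule_format])
  then obtain A where "A \<in> Sets M" "\<forall>a. a \<in> A \<longleftrightarrow> sat M ((\<lambda>_. \<zero>)(1 := a)) (\<lambda>_. T) ?\<phi>" ..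
  moreover from this have "A = {x. \<exists>s. pair_code M x s \<in> T}" by auto
  ultimately show ?thesis by simp
qed

section \<open>Recursion\<close>

context projection_closed
begin

text \<open>Initial segments of \<open>H\<close> are approximated by codes obeying the recursion
  below \<open>n\<close>. Such codes exist for every \<open>n\<close> and agree where both apply, so
  \<open>H\<close> can be read off from any of them; existence is \<open>decidable\<close> in this
  locale and ordinary induction covers it.\<close>

lemma recursion:
  assumes \<Phi>: "decidable (\<lambda>e. \<Phi> (coded (e 0) (e (Suc 0))) (e (Suc (Suc 0))))"
    and local: "\<And>X Y n. \<forall>k. k \<prec> n \<longrightarrow> X k = Y k \<Longrightarrow> \<Phi> X n = \<Phi> Y n"
  shows "\<exists>H\<in>Sets M. \<forall>n. n \<in> H \<longleftrightarrow> \<Phi> (\<lambda>k. k \<in> H) n"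
proof -
  define correct where
    "correct c m n \<longleftrightarrow> (\<forall>k. k \<prec> n \<longrightarrow> (coded c m k \<longleftrightarrow> \<Phi> (coded c m) k))" for c m n
  have \<Phi>': "decidable (\<lambda>e. \<Phi> (coded (e i) (e j)) (e k))" for i j k
    using decidable_cons2[OF \<Phi>, of i j "\<lambda>_. k"] by simp
  note intros = decidable_intros decidable_ex decidable_coded \<Phi>'
  have agree: "coded c m k \<longleftrightarrow> coded c' m' k"
    if "correct c m n" "correct c' m' n'" "k \<prec> n" "k \<prec> n'" for c m c' m' n n' k
  proof -
    let ?P = "\<lambda>e. e 0 \<prec> e (Suc 0) \<longrightarrow> e 0 \<prec> e (Suc (Suc 0)) \<longrightarrow>
      (coded (e (Suc (Suc (Suc 0)))) (e (Suc (Suc (Suc (Suc 0))))) (e 0) \<longleftrightarrow>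
       coded (e (Suc (Suc (Suc (Suc (Suc 0)))))) (e (Suc (Suc (Suc (Suc (Suc (Suc 0))))))) (e 0))"
    have P: "decidable ?P" by (intro intros)
    have "?P (k ## n ## n' ## c ## m ## c' ## (\<lambda>_. m'))"
    proof (rule strong_induction[OF P], goal_cases)
      case (1 a)
      then have IH: "d \<prec> n \<Longrightarrow> d \<prec> n' \<Longrightarrow> coded c m d \<longleftrightarrow> coded c' m' d" if "d \<prec> a" for d
        using that by simp
      have "coded c m a \<longleftrightarrow> coded c' m' a" if a: "a \<prec> n" "a \<prec> n'"
      proof -
        have "\<Phi> (coded c m) a \<longleftrightarrow> \<Phi> (coded c' m') a"
          using a IH N.less_trans by (intro local) blast
        then show ?thesis
          using \<open>correct c m n\<close> \<open>correct c' m' n'\<close> a unfolding correct_def by blast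
      qed
      then show ?case by simp
    qed
    with that show ?thesis by simp
  qed
  have ex: "\<exists>c m. correct c m n" for n
  proof -
    let ?P = "\<lambda>e. \<exists>c m. correct c m (e 0)"
    have P: "decidable ?P" unfolding correct_def by (intro intros)
    have "?P (n ## (\<lambda>_. \<zero>))"
    proof (rule induction[OF P], goal_cases)
      case 1
      then show ?case by (simp add: correct_def)
    next
      case (2 n)
      then obtain c m where c: "correct c m n" by auto
      \<comment> \<open>The new code copies the old one below \<open>n\<close> and decides
        \<open>n\<close> by \<open>\<Phi>\<close>. Position \<open>0\<close>, the witness in
        \<open>Sigma_coding\<close>, is a dummy.\<close>
      let ?Q = "\<lambda>e. e (Suc 0) \<prec> e (Suc (Suc 0)) \<and>
          coded (e (Suc (Suc (Suc 0)))) (e (Suc (Suc (Suc (Suc 0))))) (e (Suc 0)) \<or>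
        e (Suc 0) = e (Suc (Suc 0)) \<and>
          \<Phi> (coded (e (Suc (Suc (Suc 0)))) (e (Suc (Suc (Suc (Suc 0)))))) (e (Suc (Suc 0)))"
      have "decidable ?Q" by (intro intros)
      from Sigma_coding[OF this, of "n \<oplus> \<one>" "n ## c ## (\<lambda>_. m)"]
      obtain c' m' where c': "\<And>k. k \<prec> n \<oplus> \<one> \<Longrightarrow> coded c' m' k \<longleftrightarrow>
          k \<prec> n \<and> coded c m k \<or> k = n \<and> \<Phi> (coded c m) n"
        by auto
      have same: "coded c' m' k \<longleftrightarrow> coded c m k" if "k \<prec> n" for k
        using c'[of k] that by (auto simp: prec_succ_cases)
      have "correct c' m' (n \<oplus> \<one>)"
        unfolding correct_def
      proof (intro allI impI)
        fix k assume k: "k \<prec> n \<oplus> \<one>"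
        then have "\<Phi> (coded c' m') k \<longleftrightarrow> \<Phi> (coded c m) k"
          using same by (intro local) (metis N.less_le_trans prec_succ_iff)
        with k c c' same show "coded c' m' k \<longleftrightarrow> \<Phi> (coded c' m') k"
          unfolding correct_def prec_succ_cases by blast
      qed
      then show ?case by auto
    qed
    then show ?thesis by simp
  qed
  let ?H = "\<lambda>e. \<exists>c m. correct c m (e 0 \<oplus> \<one>) \<and> coded c m (e 0)"
  define H where "H = {n. ?H (n ## (\<lambda>_. \<zero>))}"
  have "decidable ?H" unfolding correct_def by (intro intros)
  then have "H \<in> Sets M" unfolding H_def by (rule comprehension)
  moreover have "n \<in> H \<longleftrightarrow> \<Phi> (\<lambda>k. k \<in> H) n" for n
  proof -
    obtain c m where c: "correct c m (n \<oplus> \<one>)" using ex by blast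
    have H: "k \<in> H \<longleftrightarrow> coded c m k" if "k \<prec> n \<oplus> \<one>" for k
    proof
      assume "k \<in> H"
      then obtain c' m' where "correct c' m' (k \<oplus> \<one>)" "coded c' m' k" by (auto simp: H_def)
      then show "coded c m k" using agree[OF c] that by (auto simp: prec_succ_iff)
    next
      assume "coded c m k"
      moreover have "correct c m (k \<oplus> \<one>)"
        using c that unfolding correct_def prec_succ_iff by (meson N.order_trans)
      ultimately show "k \<in> H" by (auto simp: H_def)
    qed
    then have "\<Phi> (\<lambda>k. k \<in> H) n \<longleftrightarrow> \<Phi> (coded c m) n"
      by (intro local) (simp add: prec_succ_cases)
    with c H show ?thesis unfolding correct_def prec_succ_cases by blast
  qed
  ultimately show ?thesis by blast
qed

text \<open>
  \<open>D\<close> lists requirements: \<open>H\<close> has to meet every section \<open>D\<^sub>r\<close>, while a number \<open>h\<close> in \<open>H\<close> forbids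
  the elements of \<open>B\<^sub>h\<close> above it. A number enters \<open>H\<close> if it is not forbidden and meets the least
  requirement that is not yet met.
\<close>

lemma generic_set:
  assumes D: "D \<in> Sets M" and B: "B \<in> Sets M"
    and D_inf: "\<And>r b. \<exists>n. b \<preceq> n \<and> pair_code M r n \<in> D"
    and B_fin: "\<And>h. \<exists>b. \<forall>n. pair_code M h n \<in> B \<longrightarrow> n \<prec> b"
  obtains H where "H \<in> Sets M"
    "\<And>n. n \<in> H \<Longrightarrow> \<exists>r. pair_code M r n \<in> D"
    "\<And>h n. h \<in> H \<Longrightarrow> n \<in> H \<Longrightarrow> h \<prec> n \<Longrightarrow> pair_code M h n \<notin> B"
    "\<And>r. \<exists>n\<in>H. pair_code M r n \<in> D"
proof -
  define \<Phi> where "\<Phi> X n \<longleftrightarrow> (\<forall>h. h \<prec> n \<longrightarrow> X h \<longrightarrow> pair_code M h n \<notin> B) \<and>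
    (\<exists>r. pair_code M r n \<in> D \<and> (\<forall>h. h \<prec> n \<longrightarrow> X h \<longrightarrow> pair_code M r h \<notin> D) \<and>
      (\<forall>q. q \<prec> r \<longrightarrow> (\<exists>h. h \<prec> n \<and> X h \<and> pair_code M q h \<in> D)))" for X n
  have "decidable (\<lambda>e. \<Phi> (coded (e 0) (e (Suc 0))) (e (Suc (Suc 0))))"
    unfolding \<Phi>_def by (intro decidable_intros decidable_ex decidable_coded D B)
  moreover have "\<Phi> X n = \<Phi> Y n" if "\<forall>k. k \<prec> n \<longrightarrow> X k = Y k" for X Y n
    unfolding \<Phi>_def using that by (simp cong: conj_cong imp_cong)
  ultimately obtain H where HS: "H \<in> Sets M" and H: "\<And>n. n \<in> H \<longleftrightarrow> \<Phi> (\<lambda>k. k \<in> H) n"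
    using recursion[of \<Phi>] by blast
  have met: "\<exists>n\<in>H. pair_code M r n \<in> D" for r
  proof -
    let ?P = "\<lambda>e. \<exists>n. n \<in> H \<and> pair_code M (e 0) n \<in> D"
    have P: "decidable ?P" by (intro decidable_intros decidable_ex HS D)
    have "?P (r ## (\<lambda>_. \<zero>))"
    proof (rule strong_induction[OF P], rule ccontr, goal_cases)
      case (1 r)
      let ?Q = "\<lambda>e. e 0 \<in> H \<and> pair_code M (e (Suc 0)) (e 0) \<in> D"
      have "decidable ?Q" by (intro decidable_intros HS D)
      \<comment> \<open>All requirements before \<open>r\<close> are met by induction, and strong
        bounding meets them below a single \<open>b\<close>.\<close>
      from strong_bounding[OF this, of r "\<lambda>_. \<zero>"] 1(1)
      obtain b where b: "\<forall>q. q \<prec> r \<longrightarrow> (\<exists>n. n \<prec> b \<and> n \<in> H \<and> pair_code M q n \<in> D)"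
        by auto
      have unmet: "pair_code M r n \<notin> D" if "n \<in> H" for n
        using 1(2) that by auto
      \<comment> \<open>An element beyond \<open>b\<close> would have entered for some requirement
        \<open>q\<close>. Those before \<open>r\<close> are already met below \<open>b\<close>, and
        a \<open>q\<close> from \<open>r\<close> on would need \<open>r\<close> to be met.\<close>
      have H_below: "n \<prec> b" if n: "n \<in> H" for n
      proof (rule ccontr)
        assume "\<not> n \<prec> b"
        then have "b \<preceq> n" by (simp add: N.not_less)
        from n have "\<Phi> (\<lambda>k. k \<in> H) n" using H by blast
        then obtain q where q: "pair_code M q n \<in> D" "\<And>h. h \<prec> n \<Longrightarrow> h \<in> H \<Longrightarrow> pair_code M q h \<notin> D"
          and below: "\<And>q'. q' \<prec> q \<Longrightarrow> \<exists>h. h \<in> H \<and> pair_code M q' h \<in> D"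
          unfolding \<Phi>_def by blast
        have "\<not> q \<prec> r"
          using q(2) b \<open>b \<preceq> n\<close> N.less_le_trans by blast
        moreover have "\<not> r \<prec> q" using below unmet by blast
        ultimately show False using prec_total[of q r] q(1) n unmet by blast
      qed
      \<comment> \<open>As \<open>H\<close> lies below \<open>b\<close>, strong bounding confines
        everything it forbids below one \<open>b'\<close>. A number beyond both bounds that meets
        \<open>r\<close> must therefore enter \<open>H\<close>, a contradiction.\<close>
      let ?R = "\<lambda>e. \<forall>n. pair_code M (e (Suc 0)) n \<in> B \<longrightarrow> n \<prec> e 0"
      have "decidable ?R" by (intro decidable_intros decidable_all B)
      from strong_bounding[OF this, of b "\<lambda>_. \<zero>"] B_fin
      obtain b' where b': "\<forall>h. h \<prec> b \<longrightarrow> (\<exists>s. s \<prec> b' \<and> (\<forall>n. pair_code M h n \<in> B \<longrightarrow> n \<prec> s))"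
        by auto
      obtain n where n: "N.max b b' \<preceq> n" "pair_code M r n \<in> D" using D_inf by blast
      have "pair_code M h n \<notin> B" if "h \<in> H" for h
        using b' H_below[OF that] n(1)
        by (meson N.less_le_trans N.less_trans N.max.boundedE N.less_irrefl)
      moreover have "\<exists>h. h \<prec> n \<and> h \<in> H \<and> pair_code M q h \<in> D" if "q \<prec> r" for q
        using b that n(1) by (meson N.less_le_trans N.max.boundedE)
      ultimately have "n \<in> H"
        unfolding H[of n] \<Phi>_def using n(2) unmet by blast
      then show False using unmet n(2) by blast
    qed
    then show ?thesis by auto
  qed
  show thesis
  proof (rule that[OF HS _ _ met])
    show "\<exists>r. pair_code M r n \<in> D" if "n \<in> H" for n
      using that unfolding H[of n] \<Phi>_def by blast
    show "pair_code M h n \<notin> B" if "h \<in> H" "n \<in> H" "h \<prec> n" for h n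
      using that unfolding H[of n] \<Phi>_def by blast
  qed
qed

end

section \<open>The Rival--Sands theorem\<close>

context projection_closed
begin

lemma refined_Rival_Sands: "RSgr M"
  unfolding RSgr_def
proof (intro allI impI, elim conjE)
  fix V E
  assume G: "coded_graph M V E" and V_inf: "internally_infinite M V"
  have V: "V \<in> Sets M" and E: "E \<in> Sets M"
    using G unfolding coded_graph_def by auto
  define adj where "adj x y \<longleftrightarrow> y \<in> nbrs M V E x" for x y
  have decidable_adj: "decidable (\<lambda>e. adj (s e) (t e))"
    if "definable_term s" "definable_term t" for s t
    unfolding adj_def nbrs_def mem_Collect_eq by (intro decidable_intros that V E)
  have adj_sym: "adj y x" if "adj x y" "x \<in> V" for x y
    using that unfolding adj_def nbrs_def by auto
  have adj_irrefl: "\<not> adj x x" for x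
    unfolding adj_def nbrs_def by auto
  note intros = decidable_intros decidable_ex decidable_all decidable_adj
  let ?F = "\<lambda>e. e 0 \<in> V \<and> (\<exists>b. \<forall>y. adj (e 0) y \<longrightarrow> y \<prec> b)"
  define F where "F = {x. ?F (x ## (\<lambda>_. \<zero>))}"
  have "decidable ?F" by (intro intros V)
  then have FS: "F \<in> Sets M" unfolding F_def by (rule comprehension)
  have F: "x \<in> F \<longleftrightarrow> x \<in> V \<and> (\<exists>b. \<forall>y. adj x y \<longrightarrow> y \<prec> b)" for x
    by (simp add: F_def)
  have F_bound: "\<exists>b. \<forall>x. x \<prec> n \<longrightarrow> x \<in> F \<longrightarrow> (\<forall>y. adj x y \<longrightarrow> y \<prec> b)" for n
  proof -
    let ?P = "\<lambda>e. \<forall>y. adj (e (Suc 0)) y \<longrightarrow> y \<prec> e 0"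
    have "decidable ?P" by (intro intros)
    from strong_bounding[OF this, of n "\<lambda>_. \<zero>"]
    obtain b where "\<forall>x. x \<prec> n \<longrightarrow> (\<exists>s. \<forall>y. adj x y \<longrightarrow> y \<prec> s) \<longrightarrow>
        (\<exists>s. s \<prec> b \<and> (\<forall>y. adj x y \<longrightarrow> y \<prec> s))"
      by auto
    then show ?thesis using N.less_trans unfolding F by blast
  qed
  show "\<exists>H. RS_refined_solution M V E H"
  proof (cases "internally_finite M F")
    case True
    then obtain n where n: "\<And>x. x \<in> F \<Longrightarrow> x \<prec> n"
      unfolding internally_finite_def by blast
    obtain b where b: "\<And>x y. x \<in> F \<Longrightarrow> adj x y \<Longrightarrow> y \<prec> b"
      using F_bound[of n] n by blast
    \<comment> \<open>Since \<open>b\<close> exceeds all neighbours of vertices in \<open>F\<close>,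
      these have no neighbour in \<open>H\<close>; every other vertex loses only finitely
      many.\<close>
    let ?H = "\<lambda>e. e 0 \<in> V \<and> e (Suc 0) \<preceq> e 0"
    define H where "H = {v. ?H (v ## (\<lambda>_. b))}"
    have "decidable ?H" by (intro intros V)
    then have HS: "H \<in> Sets M" unfolding H_def by (rule comprehension)
    have H: "v \<in> H \<longleftrightarrow> v \<in> V \<and> b \<preceq> v" for v by (simp add: H_def)
    have inf: "internally_infinite M (H \<inter> A)" if A: "internally_infinite M A" "A \<subseteq> V" for A
      unfolding internally_infinite_iff
    proof
      fix c
      obtain y where "y \<in> A" "N.max b c \<preceq> y"
        using A unfolding internally_infinite_iff by blast
      with A(2) show "\<exists>y\<in>H \<inter> A. c \<preceq> y" by (intro bexI[of _ y]) (auto simp: H)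
    qed
    have "H \<inter> nbrs M V E x = {}" if "x \<in> F" for x
      using b[OF that] by (auto simp: H adj_def[symmetric] not_leq[symmetric])
    moreover have "internally_infinite M (H \<inter> nbrs M V E x)" if "x \<in> V" "x \<notin> F" for x
      using that by (intro inf) (auto simp: F internally_finite_def adj_def nbrs_def)
    moreover have "internally_infinite M H"
      using inf[OF V_inf] by (simp add: Int_absorb2 H subset_iff)
    moreover have "H \<subseteq> V" by (auto simp: H)
    ultimately have "RS_refined_solution M V E H"
      using HS unfolding RS_refined_solution_def RS_solution_def by blast
    then show ?thesis by blast
  next
    case False
    txt \<open>
      \<open>H \<subseteq> F\<close> is made to meet \<open>F \<inter> N(y)\<close> infinitely often whenever this set is infinite. All other
      \<open>y\<close> adjacent to some \<open>h \<in> H\<close> are finitely many, and their neighbours in \<open>F\<close> are forbidden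
      above \<open>h\<close>.
    \<close>
    define I where "I y \<longleftrightarrow> y \<in> V \<and> (\<forall>b. \<exists>n. b \<preceq> n \<and> n \<in> F \<and> adj y n)" for y
    have decidable_I: "decidable (\<lambda>e. I (t e))" if "definable_term t" for t
      unfolding I_def by (intro intros V FS that term_shift)
    \<comment> \<open>For \<open>I y\<close>, requirement \<open>(y, j)\<close> asks for an element
      of \<open>F \<inter> N(y)\<close> from \<open>j\<close> on; over all \<open>j\<close> this
      makes the intersection with \<open>H\<close> infinite. Every other number \<open>r\<close>
      asks for an element of \<open>F\<close> from \<open>r\<close> on, which makes \<open>H\<close>
      infinite if no \<open>y\<close> satisfies \<open>I\<close>.\<close>
    let ?D = "\<lambda>e. (\<exists>y j. e 0 = pair_code M y j \<and> I y \<and> adj y (e (Suc 0)) \<and>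
        e (Suc 0) \<in> F \<and> j \<preceq> e (Suc 0)) \<or>
      \<not> (\<exists>y j. e 0 = pair_code M y j \<and> I y) \<and> e (Suc 0) \<in> F \<and> e 0 \<preceq> e (Suc 0)"
    have "decidable ?D" by (intro intros decidable_I FS)
    from comprehension_pairs[OF this, of "\<lambda>_. \<zero>"]
    obtain D where D: "D \<in> Sets M" "\<forall>r n. pair_code M r n \<in> D \<longleftrightarrow> ?D (r ## n ## (\<lambda>_. \<zero>))"
      by (elim bexE conjE) (rule that)
    let ?B = "\<lambda>e. e 0 \<in> F \<and> (adj (e 0) (e (Suc 0)) \<or>
      (\<exists>y. adj (e 0) y \<and> \<not> I y \<and> adj y (e (Suc 0)) \<and> e (Suc 0) \<in> F))"
    have "decidable ?B" by (intro intros decidable_I FS)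
    from comprehension_pairs[OF this, of "\<lambda>_. \<zero>"]
    obtain B where B: "B \<in> Sets M" "\<forall>h n. pair_code M h n \<in> B \<longleftrightarrow> ?B (h ## n ## (\<lambda>_. \<zero>))"
      by (elim bexE conjE) (rule that)
    have D_I: "pair_code M (pair_code M y j) n \<in> D \<longleftrightarrow> adj y n \<and> n \<in> F \<and> j \<preceq> n" if "I y" for y j n
      using that by (auto simp: D(2))
    have D_default: "pair_code M r n \<in> D \<longleftrightarrow> n \<in> F \<and> r \<preceq> n" if "\<nexists>y j. r = pair_code M y j \<and> I y" for r n
      using that by (auto simp: D(2))
    have D_inf: "\<exists>n. b \<preceq> n \<and> pair_code M r n \<in> D" for r b
    proof (cases "\<exists>y j. r = pair_code M y j \<and> I y")
      case True
      then obtain y j where r: "r = pair_code M y j" "I y" by blast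
      then obtain n where "N.max b j \<preceq> n" "n \<in> F" "adj y n" unfolding I_def by blast
      with r show ?thesis by (auto simp: D_I)
    next
      case no: False
      obtain n where "n \<in> F" "N.max b r \<preceq> n"
        using False unfolding internally_infinite_iff by blast
      with no show ?thesis by (auto simp: D_default)
    qed
    have B_fin: "\<exists>b. \<forall>n. pair_code M h n \<in> B \<longrightarrow> n \<prec> b" for h
    proof (cases "h \<in> F")
      case True
      then obtain b where b: "\<And>y. adj h y \<Longrightarrow> y \<prec> b" unfolding F by blast
      \<comment> \<open>The neighbours of \<open>h\<close> lie below \<open>b\<close>, so strong
        bounding gives one \<open>c\<close> beyond all the finite sets
        \<open>F \<inter> N(y)\<close> involved.\<close>
      let ?P = "\<lambda>e. \<forall>n. adj (e (Suc 0)) n \<longrightarrow> n \<in> F \<longrightarrow> n \<prec> e 0"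
      have "decidable ?P" by (intro intros FS)
      from strong_bounding[OF this, of b "\<lambda>_. \<zero>"]
      obtain c where c: "\<forall>y. y \<prec> b \<longrightarrow> (\<exists>s. \<forall>n. adj y n \<longrightarrow> n \<in> F \<longrightarrow> n \<prec> s) \<longrightarrow>
          (\<exists>s. s \<prec> c \<and> (\<forall>n. adj y n \<longrightarrow> n \<in> F \<longrightarrow> n \<prec> s))"
        by auto
      have "n \<prec> c" if "adj h y" "\<not> I y" "adj y n" "n \<in> F" for y n
      proof -
        have "y \<in> V" using \<open>adj h y\<close> unfolding adj_def nbrs_def by blast
        with \<open>\<not> I y\<close> obtain s where "\<forall>n. adj y n \<longrightarrow> n \<in> F \<longrightarrow> n \<prec> s"
          unfolding I_def by (meson not_leq)
        then show ?thesis using c b that N.less_trans by meson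
      qed
      with b show ?thesis
        by (intro exI[of _ "N.max b c"]) (auto simp: B(2) N.less_max_iff_disj)
    next
      case False
      then show ?thesis by (auto simp: B(2))
    qed
    obtain H where HS: "H \<in> Sets M"
      and HD: "\<And>n. n \<in> H \<Longrightarrow> \<exists>r. pair_code M r n \<in> D"
      and HB: "\<And>h n. h \<in> H \<Longrightarrow> n \<in> H \<Longrightarrow> h \<prec> n \<Longrightarrow> pair_code M h n \<notin> B"
      and met: "\<And>r. \<exists>n\<in>H. pair_code M r n \<in> D"
      using generic_set[OF D(1) B(1) D_inf B_fin] by blast
    have HF: "H \<subseteq> F" using HD by (auto simp: D(2))
    have HV: "H \<subseteq> V" using HF F by blast
    have inf: "internally_infinite M (H \<inter> nbrs M V E x)" if "I x" for x
      unfolding internally_infinite_iff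
    proof
      fix b
      show "\<exists>y\<in>H \<inter> nbrs M V E x. b \<preceq> y"
        using met[of "pair_code M x b"] by (auto simp: D_I[OF that] adj_def)
    qed
    have "internally_infinite M H"
    proof (cases "\<exists>x. I x")
      case True
      then show ?thesis using inf unfolding internally_infinite_iff by blast
    next
      case no: False
      show ?thesis
        unfolding internally_infinite_iff
      proof
        fix b
        show "\<exists>y\<in>H. b \<preceq> y" using met[of b] D_default[of b] no by blast
      qed
    qed
    moreover have "y = z" if x: "x \<in> V" "\<not> I x" and yz: "y \<in> H" "z \<in> H" "adj x y" "adj x z" for x y z
    proof -
      \<comment> \<open>The vertex \<open>x\<close> is itself a neighbour of \<open>y\<close> that
        fails \<open>I\<close>, so \<open>y\<close> forbids any larger \<open>z\<close> in
        \<open>F \<inter> N(x)\<close>.\<close>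
      have "\<not> y \<prec> z" if "y \<in> H" "z \<in> H" "adj x y" "adj x z" for y z
        using HB[of y z] that x HF adj_sym[of x y] by (auto simp: B(2))
      then show ?thesis using yz prec_total by blast
    qed
    \<comment> \<open>\<open>H\<close> is independent: of two adjacent members the smaller would
      forbid the larger.\<close>
    moreover have "H \<inter> nbrs M V E x = {}" if "x \<in> H" for x
    proof -
      have False if y: "y \<in> H" "adj x y" for y
      proof -
        have "adj y x" using adj_sym y \<open>x \<in> H\<close> HV by blast
        moreover have "x \<noteq> y" using y adj_irrefl by blast
        ultimately show False
          using HB[of x y] HB[of y x] prec_total[of x y] y \<open>x \<in> H\<close> HF by (auto simp: B(2))
      qed
      then show ?thesis by (auto simp: adj_def)
    qed
    ultimately have "RS_refined_solution M V E H"
      using HS HV inf unfolding RS_refined_solution_def RS_solution_def adj_def by blast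
    then show ?thesis by blast
  qed
qed

end

theorem theorem3p5:
  fixes M :: "'a l2_structure"
  assumes "RCA0 M"
  shows "(ACA0 M \<longleftrightarrow> RSg M) \<and>
         (ACA0 M \<longleftrightarrow> RSgr M) \<and>
         (ACA0 M \<longleftrightarrow> RSg_locally_finite M) \<and>
         (ACA0 M \<longleftrightarrow> RSgr_locally_finite M)"
proof -
  interpret rca0_model M by unfold_locales (rule assms)
  have "RSgr M" if "ACA0 M"
  proof -
    interpret projection_closed M
      using that arithmetical_comprehension_imp_projection
      by unfold_locales (auto simp: ACA0_def)
    show ?thesis by (rule refined_Rival_Sands)
  qed
  moreover have "ACA0 M" if "RSg_locally_finite M"
  proof -
    interpret projection_closed M
      using that RSg_locally_finite_imp_projection by unfold_locales
    show ?thesis using assms arithmetical_comprehension by (simp add: ACA0_def)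
  qed
  \<comment> \<open>The remaining implications lead from the strongest statement,
    \<open>RSgr\<close>, down to the weakest, \<open>RSg_locally_finite\<close>, and close the
    cycle.\<close>
  moreover have "RSgr M \<Longrightarrow> RSg M" "RSgr M \<Longrightarrow> RSgr_locally_finite M"
    "RSg M \<Longrightarrow> RSg_locally_finite M" "RSgr_locally_finite M \<Longrightarrow> RSg_locally_finite M"
    unfolding RSgr_def RSg_def RSgr_locally_finite_def RSg_locally_finite_def
      RS_refined_solution_def by blast+
  ultimately show ?thesis by blast
qed

end
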